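(* Let $\Bbbk$ be a field, let $G$ be a finite simple graph on the $n$ vertices $\{x_1,\ldots,x_n\}$, let $q\ge1$, let $R=\Bbbk[x_1,\ldots,x_n]$ and $S=R[v]$. Let $\mathrm{Cone}(G)$ be the graph obtained from $G$ by adding a new vertex $v$ adjacent to every vertex of $G$. If \[ d_1:=\operatorname{depth}_R\big(R/I(G)^{[q]}\big)\;>\;d_2:=\operatorname{depth}_R\big(R/J_{G,q}\big), \] then \[ \operatorname{depth}_S\big(S/I(\mathrm{Cone}(G))^{[q]}\big)=d_2+1 . \]
   Context: A $q$-matching of a graph is a set $M$ of $q$ pairwise vertex-disjoint edges; $V(M)$ is the set of vertices covered by $M$, and $x_{V(M)}$ is the product of the variables corresponding to the vertices in $V(M)$. For a graph $X$, the $q$-th squarefree power $I(X)^{[q]}$ is the ideal, in the polynomial ring over $\Bbbk$ whose variables are the vertices of $X$, generated by all $x_{V(M)}$ with $M$ a $q$-matching of $X$. The ideal $J_{G,q}\subseteq R$ is \[ J_{G,q}:=\big(x_j\cdot x_{V(M')} : x_j\in V(G),\ M'\text{ a }(q-1)\text{-matching of }G\setminus\{x_j\}\big), \] where $G\setminus\{x_j\}$ is the graph with vertex $x_j$ deleted; for $q=1$ the only $0$-matching is the empty one, so $J_{G,1}=(x_1,\ldots,x_n)$. Depth is taken with respect to the homogeneous maximal ideal of the polynomial ring. *)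

theory Defs
  imports Main "HOL-Library.Poly_Mapping" "HOL-Library.Extended_Nat"
begin

section \<open>Ideals and depth\<close>

text \<open>Ideals of a commutative ring are its submodules, so the ideal generated by a set is the span
  of this set in the ring, regarded as a module over itself.\<close>

global_interpretation ideal: module "(*) :: 'a \<Rightarrow> 'a \<Rightarrow> 'a::comm_ring_1"
  by unfold_locales (simp_all add: algebra_simps)

text \<open>For a ring \<open>R\<close> and an ideal \<open>I\<close>, write \<open>M = R/I\<close>. The module \<open>M/(f\<^sub>1,\<dots>,f\<^sub>i)M\<close> is \<open>R/J\<close>,
  where \<open>J = I + (f\<^sub>1,\<dots>,f\<^sub>i)\<close>. An element \<open>f\<close> is a nonzerodivisor on \<open>R/J\<close> if \<open>f g \<in> J\<close>
  implies \<open>g \<in> J\<close>, for all \<open>g\<close>.\<close>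

definition nonzerodivisor_mod :: "'a::comm_ring_1 set \<Rightarrow> 'a \<Rightarrow> bool" where
  "nonzerodivisor_mod J f \<longleftrightarrow> (\<forall>g. f * g \<in> J \<longrightarrow> g \<in> J)"

definition regular_sequence_mod :: "'a::comm_ring_1 set \<Rightarrow> 'a list \<Rightarrow> bool" where
  "regular_sequence_mod I fs \<longleftrightarrow>
     (\<forall>i < length fs. nonzerodivisor_mod (ideal.span (I \<union> set (take i fs))) (fs ! i)) \<and>
     ideal.span (I \<union> set fs) \<noteq> UNIV"

text \<open>The depth of \<open>R/I\<close> with respect to an ideal \<open>\<mm>\<close>: the supremum of the lengths of the
  \<open>R/I\<close>-regular sequences in \<open>\<mm>\<close>. It is meant for \<open>I + \<mm> \<noteq> R\<close>; the value \<open>\<infinity>\<close> that is customary in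
  the excluded case is not built in.\<close>

definition depth_mod :: "'a::comm_ring_1 set \<Rightarrow> 'a set \<Rightarrow> enat" where
  "depth_mod \<mm> I = (SUP fs \<in> {fs. set fs \<subseteq> \<mm> \<and> regular_sequence_mod I fs}. enat (length fs))"


section \<open>Polynomials\<close>

text \<open>The polynomial ring over \<open>'k\<close> whose variables are the elements of the type \<open>'v\<close>. Exponent
  vectors are finitely supported functions \<open>'v \<Rightarrow>\<^sub>0 nat\<close>.\<close>

type_synonym ('v, 'k) mpoly = "('v \<Rightarrow>\<^sub>0 nat) \<Rightarrow>\<^sub>0 'k"

definition var :: "'v \<Rightarrow> ('v, 'k::field) mpoly" where
  "var x = Poly_Mapping.single (Poly_Mapping.single x 1) 1"

definition irrelevant_ideal :: "('v, 'k::field) mpoly set" where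
  "irrelevant_ideal = ideal.span (range var)"

text \<open>\<open>depth (R/I)\<close> with respect to the homogeneous maximal ideal of the polynomial ring \<open>R\<close>.\<close>

definition depth_quot :: "('v, 'k::field) mpoly set \<Rightarrow> enat" where
  "depth_quot I = depth_mod irrelevant_ideal I"


section \<open>Graphs, matchings and squarefree powers\<close>

text \<open>A simple graph is given by its set of edges, which are two-element sets of vertices. The vertex
  set is the whole type \<open>'v\<close>, except for \<open>delete_vertex E x\<close>, which is the graph
  on the vertices other than \<open>x\<close>.\<close>

definition simple_graph :: "'v set set \<Rightarrow> bool" where
  "simple_graph E \<longleftrightarrow> (\<forall>e\<in>E. card e = 2)"

definition delete_vertex :: "'v set set \<Rightarrow> 'v \<Rightarrow> 'v set set" where
  "delete_vertex E x = {e \<in> E. x \<notin> e}"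

text \<open>The vertices of the cone are \<open>Some x\<close>, for the vertices \<open>x\<close> of the graph, and the new vertex
  \<open>None\<close>.\<close>

definition cone :: "'v set set \<Rightarrow> 'v option set set" where
  "cone E = (\<lambda>e. Some ` e) ` E \<union> {{None, Some x} | x. True}"

definition is_matching :: "'v set set \<Rightarrow> nat \<Rightarrow> 'v set set \<Rightarrow> bool" where
  "is_matching E q M \<longleftrightarrow> M \<subseteq> E \<and> finite M \<and> card M = q \<and> pairwise disjnt M"

text \<open>For a matching \<open>M\<close>, the set of covered vertices is \<open>\<Union>M\<close>.\<close>

definition vertex_monomial :: "'v set \<Rightarrow> ('v, 'k::field) mpoly" where
  "vertex_monomial A = (\<Prod>x\<in>A. var x)"

definition squarefree_power :: "'v set set \<Rightarrow> nat \<Rightarrow> ('v, 'k::field) mpoly set" where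
  "squarefree_power E q = ideal.span {vertex_monomial (\<Union>M) | M. is_matching E q M}"

definition J_ideal :: "'v set set \<Rightarrow> nat \<Rightarrow> ('v, 'k::field) mpoly set" where
  "J_ideal E q = ideal.span
     {var x * vertex_monomial (\<Union>M) | x M. is_matching (delete_vertex E x) (q - 1) M}"

end

theory Submission imports Defs begin

text \<open>Let \<open>I = I(G)\<^sup>[\<^sup>q\<^sup>]\<close>, \<open>J = J\<^bsub>G,q\<^esub>\<close> and \<open>L = I(Cone G)\<^sup>[\<^sup>q\<^sup>]\<close>. A \<open>q\<close>-matching of the cone either avoids
  the apex \<open>v\<close> or consists of an edge from \<open>v\<close> to a vertex \<open>x\<close> and a \<open>(q-1)\<close>-matching of \<open>G\<close> without
  \<open>x\<close>. Hence \<open>L = I S + v J S\<close> (\<open>matching_exponents_cone\<close>). Moreover \<open>I \<subseteq> J\<close>: in the monomial of a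
  \<open>q\<close>-matching, one endpoint of one edge can be cancelled. Looking at monomials one finds
  \<open>L : v = J S\<close> and \<open>L + (v) = I S + (v)\<close>, so that multiplication by \<open>v\<close> gives the exact sequence
  \<open>0 \<rightarrow> S/JS \<rightarrow> S/L \<rightarrow> R/I \<rightarrow> 0\<close>. The outer terms have depth \<open>d\<^sub>2 + 1\<close> and \<open>d\<^sub>1 \<ge> d\<^sub>2 + 1\<close>. By the depth
  lemma, \<open>depth S/L \<ge> d\<^sub>2 + 1\<close>; and \<open>depth S/L \<ge> d\<^sub>2 + 2\<close> would imply \<open>depth S/JS \<ge> d\<^sub>2 + 2\<close>.\<close>

text \<open>The theory of depth that this needs concerns cyclic modules over a Noetherian ring only and has an
  elementary proof, without homological algebra. An exact sequence
  \<open>0 \<rightarrow> S/(L : v) \<rightarrow> S/L \<rightarrow> S/(L + v) \<rightarrow> 0\<close> stays a sequence of this form, for the ideal \<open>L + (f)\<close>, after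
  reduction modulo an element \<open>f\<close> that is regular on the last term (\<open>colon_adjoin\<close>). The depth lemma
  therefore follows by induction from two facts. First, finitely many cyclic modules of positive depth
  have a common nonzerodivisor in \<open>\<mm>\<close>; this is prime avoidance, applied to the maximal annihilators of
  elements (\<open>common_nonzerodivisor\<close>). Second, reduction modulo \<^emph>\<open>any\<close> nonzerodivisor in \<open>\<mm>\<close> lowers the
  depth by exactly one (\<open>depth_at_least_Suc_iff\<close>, a theorem of Rees). Polynomial rings are
  Noetherian by Dickson's lemma.\<close>

(* Products are normalised by mult.assoc below, also as a member of algebra_simps; this rule is the
   same equation in the opposite direction, and the two together make the simplifier loop. *)

declare ideal.scale_scale [simp del]

section \<open>Ideals\<close>

definition adjoin :: "'a::comm_ring_1 set \<Rightarrow> 'a \<Rightarrow> 'a set" where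
  "adjoin I f = ideal.span (insert f I)"

lemma ideal_adjoin [simp]: "ideal.subspace (adjoin I f)"
  by (simp add: adjoin_def)

lemma mem_adjoin_iff:
  assumes "ideal.subspace I"
  shows "x \<in> adjoin I f \<longleftrightarrow> (\<exists>i\<in>I. \<exists>k. x = i + k * f)"
proof -
  have "x \<in> adjoin I f \<longleftrightarrow> (\<exists>k. x - k * f \<in> I)"
    using assms by (simp add: adjoin_def ideal.span_breakdown_eq ideal.span_eq_iff[THEN iffD2])
  also have "\<dots> \<longleftrightarrow> (\<exists>i\<in>I. \<exists>k. x = i + k * f)"
    by (metis add_diff_cancel_right' diff_add_cancel)
  finally show ?thesis .
qed

lemma subset_adjoin: "I \<subseteq> adjoin I f"
  unfolding adjoin_def using ideal.span_superset[of "insert f I"] by blast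

lemma adjoin_subset: "ideal.subspace J \<Longrightarrow> I \<subseteq> J \<Longrightarrow> f \<in> J \<Longrightarrow> adjoin I f \<subseteq> J"
  unfolding adjoin_def by (rule ideal.span_minimal) auto

lemma adjoin_commute: "adjoin (adjoin I f) g = adjoin (adjoin I g) f"
proof -
  have "adjoin (adjoin I a) b \<subseteq> adjoin (adjoin I b) a" for a b
  proof (intro adjoin_subset ideal_adjoin)
    show "I \<subseteq> adjoin (adjoin I b) a"
      using subset_adjoin by blast
    show "a \<in> adjoin (adjoin I b) a" "b \<in> adjoin (adjoin I b) a"
      unfolding adjoin_def by (simp_all add: ideal.span_base)
  qed
  then show ?thesis by blast
qed

definition colon :: "'a::comm_ring_1 set \<Rightarrow> 'a \<Rightarrow> 'a set" where
  "colon I g = {f. f * g \<in> I}"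

lemma ideal_colon: 
  assumes I: "ideal.subspace I"
  shows "ideal.subspace (colon I g)"
proof (rule ideal.subspaceI)
  show "0 \<in> colon I g" using ideal.subspace_0[OF I] by (simp add: colon_def)
  show "x + y \<in> colon I g" if "x \<in> colon I g" "y \<in> colon I g" for x y
    using ideal.subspace_add[OF I, of "x * g" "y * g"] that by (simp add: colon_def distrib_right)
  show "c * x \<in> colon I g" if "x \<in> colon I g" for c x
    using ideal.subspace_scale[OF I, of "x * g" c] that by (simp add: colon_def mult.assoc)
qed

lemma nonzerodivisor_colon:
  "nonzerodivisor_mod I f \<Longrightarrow> nonzerodivisor_mod (colon I v) f"
  unfolding nonzerodivisor_mod_def colon_def mem_Collect_eq mult.assoc by blast

lemma nonzerodivisor_modD: "nonzerodivisor_mod I f \<Longrightarrow> f * g \<in> I \<Longrightarrow> g \<in> I"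
  unfolding nonzerodivisor_mod_def by blast

definition prime_ideal :: "'a::comm_ring_1 set \<Rightarrow> bool" where
  "prime_ideal P \<longleftrightarrow> ideal.subspace P \<and> 1 \<notin> P \<and> (\<forall>a b. a * b \<in> P \<longrightarrow> a \<in> P \<or> b \<in> P)"

lemma prime_ideal_prod_mem:
  assumes "prime_ideal P" and "finite F"
  shows "(\<Prod>x\<in>F. f x) \<in> P \<Longrightarrow> \<exists>x\<in>F. f x \<in> P"
  using assms(2)
proof (induction F rule: finite_induct)
  case (insert x F)
  then have "f x \<in> P \<or> (\<Prod>x\<in>F. f x) \<in> P"
    using assms(1) unfolding prime_ideal_def by simp
  then show ?case using insert.IH by blast
qed (use assms(1) in \<open>simp add: prime_ideal_def\<close>)

lemma prod_mem_ideal: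
  assumes "ideal.subspace I" "finite F" "y \<in> F" "f y \<in> I"
  shows "(\<Prod>x\<in>F. f x) \<in> I"
proof -
  have "(\<Prod>x\<in>F. f x) = (\<Prod>x\<in>F - {y}. f x) * f y"
    using assms(2,3) by (simp add: prod.remove mult.commute)
  then show ?thesis using assms(1,4) by (simp add: ideal.subspace_scale)
qed

lemma prime_ideal_contains_factor:
  assumes P: "prime_ideal P" and "finite F"
    and ideals: "\<And>x. x \<in> F \<Longrightarrow> ideal.subspace (Q x)" and sub: "(\<Inter>x\<in>F. Q x) \<subseteq> P"
  shows "\<exists>x\<in>F. Q x \<subseteq> P"
proof (rule ccontr)
  assume "\<not> ?thesis"
  then have "\<forall>x\<in>F. \<exists>y. y \<in> Q x \<and> y \<notin> P" by blast
  from bchoice[OF this] obtain a where a: "\<forall>x\<in>F. a x \<in> Q x \<and> a x \<notin> P" ..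
  have "(\<Prod>y\<in>F. a y) \<in> Q x" if "x \<in> F" for x
    by (rule prod_mem_ideal[OF ideals[OF that] \<open>finite F\<close> that]) (use a that in blast)
  then have "(\<Prod>y\<in>F. a y) \<in> P" using sub by blast
  from prime_ideal_prod_mem[OF P \<open>finite F\<close> this] show False using a by blast
qed

text \<open>If one of the primes contains another one, the smaller one may be dropped. Otherwise
  no prime \<open>P\<close> contains the intersection of \<open>m\<close> with the others. So if
  \<open>f\<close> avoids the others but lies in \<open>P\<close>, then \<open>f + a\<close>
  avoids all of them, where \<open>a \<in> m\<close> lies in the others but not in
  \<open>P\<close>.\<close>
lemma prime_avoidance:
  assumes "finite \<P>" and m: "ideal.subspace m"
    and "\<And>P. P \<in> \<P> \<Longrightarrow> prime_ideal P" and "\<And>P. P \<in> \<P> \<Longrightarrow> \<not> m \<subseteq> P"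
  shows "\<exists>f\<in>m. \<forall>P\<in>\<P>. f \<notin> P"
  using assms(1,3,4)
proof (induction \<P> rule: finite_psubset_induct)
  case (psubset \<P>)
  show ?case
  proof (cases "\<exists>P\<in>\<P>. \<exists>Q\<in>\<P>. Q \<noteq> P \<and> Q \<subseteq> P")
    case True
    then obtain P Q where PQ: "P \<in> \<P>" "Q \<in> \<P>" "Q \<noteq> P" "Q \<subseteq> P" by blast
    obtain f where "f \<in> m" and f: "\<forall>P\<in>\<P> - {Q}. f \<notin> P"
      using psubset.IH[of "\<P> - {Q}"] psubset.prems PQ(2) by blast
    have "f \<notin> P" using f PQ(1,3) by blast
    then have "f \<notin> Q" using PQ(4) by blast
    then have "\<forall>P\<in>\<P>. f \<notin> P" using f by blast
    then show ?thesis using \<open>f \<in> m\<close> by blast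
  next
    case incomparable: False
    show ?thesis
    proof (cases "\<P> = {}")
      case True
      then show ?thesis using ideal.subspace_0[OF m] by blast
    next
      case False
      then obtain P where P: "P \<in> \<P>" by blast
      obtain f where f: "f \<in> m" "\<And>Q. Q \<in> \<P> - {P} \<Longrightarrow> f \<notin> Q"
        using psubset.IH[of "\<P> - {P}"] psubset.prems P by blast
      show ?thesis
      proof (cases "f \<in> P")
        case False
        then show ?thesis using f by blast
      next
        case True
        have "\<not> (\<Inter>Q\<in>insert m (\<P> - {P}). Q) \<subseteq> P"
        proof
          assume "(\<Inter>Q\<in>insert m (\<P> - {P}). Q) \<subseteq> P"
          then have "\<exists>Q\<in>insert m (\<P> - {P}). Q \<subseteq> P"
          proof (intro prime_ideal_contains_factor)
            show "prime_ideal P" using psubset.prems(1) P .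
            show "finite (insert m (\<P> - {P}))" using psubset.hyps by simp
            show "ideal.subspace Q" if "Q \<in> insert m (\<P> - {P})" for Q
              using that m psubset.prems(1)[of Q] unfolding prime_ideal_def by blast
          qed
          then show False using incomparable psubset.prems(2) P by blast
        qed
        then obtain a where a: "a \<in> m" "\<And>Q. Q \<in> \<P> - {P} \<Longrightarrow> a \<in> Q" "a \<notin> P"
          by auto
        have ideals: "\<And>Q. Q \<in> \<P> \<Longrightarrow> ideal.subspace Q"
          using psubset.prems(1) unfolding prime_ideal_def by blast
        have "f + a \<notin> Q" if Q: "Q \<in> \<P>" for Q
        proof (cases "Q = P")
          case True
          then show ?thesis
            using \<open>f \<in> P\<close> a(3) ideal.subspace_diff[OF ideals[OF P], of "f + a" f] by auto
        next
          case False
          then show ?thesis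
            using f(2) a(2) Q ideal.subspace_diff[OF ideals[OF Q], of "f + a" a] by auto
        qed
        then show ?thesis using f(1) a(1) m ideal.subspace_add by blast
      qed
    qed
  qed
qed

section \<open>Nonzerodivisors over a Noetherian ring\<close>

text \<open>The ascending chain condition, stated as well-foundedness: \<open>J\<close> counts as
  smaller than \<open>I\<close> if \<open>J\<close> is strictly larger as a set.\<close>
definition noetherian :: "'a::comm_ring_1 itself \<Rightarrow> bool" where
  "noetherian _ \<longleftrightarrow> wf {(J, I :: 'a set). ideal.subspace I \<and> ideal.subspace J \<and> I \<subset> J}"

lemma noetherian_maximal_ideal:
  assumes "noetherian TYPE('a::comm_ring_1)" and "\<And>I. I \<in> X \<Longrightarrow> ideal.subspace I"
    and "(I :: 'a set) \<in> X"
  shows "\<exists>J\<in>X. \<forall>K\<in>X. J \<subseteq> K \<longrightarrow> K = J"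
proof -
  obtain J where J: "J \<in> X"
    and min: "\<And>K. (K, J) \<in> {(J, I :: 'a set). ideal.subspace I \<and> ideal.subspace J \<and> I \<subset> J} \<Longrightarrow> K \<notin> X"
    using wfE_min[OF assms(1)[unfolded noetherian_def] assms(3)] by blast
  have "K = J" if "K \<in> X" "J \<subseteq> K" for K
    using min[of K] that assms(2)[OF J] assms(2)[OF that(1)] by blast
  then show ?thesis using J by blast
qed

lemma noetherian_finite_generators:
  assumes noeth: "noetherian TYPE('a::comm_ring_1)"
  shows "\<exists>F \<subseteq> H. finite F \<and> ideal.span F = ideal.span (H :: 'a set)"
proof -
  let ?X = "ideal.span ` {F. F \<subseteq> H \<and> finite F}"
  have "\<exists>J\<in>?X. \<forall>K\<in>?X. J \<subseteq> K \<longrightarrow> K = J"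
  proof (rule noetherian_maximal_ideal[OF noeth])
    show "ideal.subspace K" if "K \<in> ?X" for K using that by blast
    show "ideal.span {} \<in> ?X" by (rule image_eqI[of _ _ "{}"]) simp_all
  qed
  then obtain J where "J \<in> ?X" and J: "\<forall>K\<in>?X. J \<subseteq> K \<longrightarrow> K = J" ..
  then obtain F where F: "F \<subseteq> H" "finite F" "J = ideal.span F" by blast
  note max = J[unfolded F(3)]
  have "h \<in> ideal.span F" if "h \<in> H" for h
  proof -
    have "ideal.span (insert h F) \<in> ?X" using F that by blast
    then have "ideal.span (insert h F) = ideal.span F"
      using max ideal.span_mono[of F "insert h F"] by blast
    then show ?thesis using ideal.span_base[of h "insert h F"] by blast
  qed
  then have "ideal.span H \<subseteq> ideal.span F"
    by (intro ideal.span_minimal) auto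
  then show ?thesis using F ideal.span_mono[OF F(1)] by blast
qed

text \<open>The annihilator \<open>colon I h\<close> of the class of \<open>h\<close> in
  \<open>R/I\<close> is maximal among the annihilators of nonzero elements. If \<open>R\<close> is
  Noetherian, these annihilators are the maximal associated primes of \<open>R/I\<close>, and
  their union is the set of zerodivisors.\<close>
definition maximal_annihilator :: "'a::comm_ring_1 set \<Rightarrow> 'a \<Rightarrow> bool" where
  "maximal_annihilator I h \<longleftrightarrow>
     h \<notin> I \<and> (\<forall>g. g \<notin> I \<longrightarrow> colon I h \<subseteq> colon I g \<longrightarrow> colon I g = colon I h)"

lemma maximal_annihilatorD:
  "maximal_annihilator I h \<Longrightarrow> h \<notin> I"
  "maximal_annihilator I h \<Longrightarrow> g \<notin> I \<Longrightarrow> colon I h \<subseteq> colon I g \<Longrightarrow> colon I g = colon I h"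
  unfolding maximal_annihilator_def by simp_all

lemma ex_maximal_annihilator:
  assumes noeth: "noetherian TYPE('a::comm_ring_1)"
    and I: "ideal.subspace I" and g: "(g :: 'a) \<notin> I"
  shows "\<exists>h. maximal_annihilator I h \<and> colon I g \<subseteq> colon I h"
proof -
  let ?X = "{colon I h | h. h \<notin> I \<and> colon I g \<subseteq> colon I h}"
  have "\<exists>J\<in>?X. \<forall>K\<in>?X. J \<subseteq> K \<longrightarrow> K = J"
  proof (rule noetherian_maximal_ideal[OF noeth])
    show "ideal.subspace K" if "K \<in> ?X" for K using that ideal_colon[OF I] by blast
    show "colon I g \<in> ?X" using g by blast
  qed
  then obtain h where h: "h \<notin> I" "colon I g \<subseteq> colon I h"
    and max: "\<forall>K\<in>?X. colon I h \<subseteq> K \<longrightarrow> K = colon I h" by blast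
  have "colon I k = colon I h" if "k \<notin> I" "colon I h \<subseteq> colon I k" for k
  proof -
    have "colon I k \<in> ?X" using that h(2) by blast
    then show ?thesis using max that(2) by blast
  qed
  then show ?thesis using h unfolding maximal_annihilator_def by blast
qed

lemma prime_maximal_annihilator:
  assumes I: "ideal.subspace I" and h: "maximal_annihilator I h"
  shows "prime_ideal (colon I h)"
  unfolding prime_ideal_def
proof (intro conjI allI impI)
  show "ideal.subspace (colon I h)" by (rule ideal_colon[OF I])
  show "1 \<notin> colon I h" using maximal_annihilatorD(1)[OF h] by (simp add: colon_def)
  fix a b assume ab: "a * b \<in> colon I h"
  show "a \<in> colon I h \<or> b \<in> colon I h"
  proof (cases "b * h \<in> I")
    case False
    have "colon I h \<subseteq> colon I (b * h)"
    proof
      fix x assume "x \<in> colon I h"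
      then have "b * (x * h) \<in> I" unfolding colon_def mem_Collect_eq by (rule ideal.subspace_scale[OF I])
      then show "x \<in> colon I (b * h)" by (simp add: colon_def mult.left_commute)
    qed
    then have "colon I (b * h) = colon I h"
      by (rule maximal_annihilatorD(2)[OF h False])
    moreover have "a \<in> colon I (b * h)" using ab by (simp add: colon_def mult.assoc)
    ultimately show ?thesis by blast
  qed (simp add: colon_def)
qed

text \<open>Let \<open>F\<close> be a finite set of generators of the ideal of all
  \<open>h\<close> with maximal annihilator. An element that annihilates all of \<open>F\<close>
  annihilates every such \<open>h\<close>; so the prime \<open>colon I h\<close> contains, and by
  maximality equals, the annihilator of a member of \<open>F\<close>.\<close>
lemma finite_maximal_annihilators:
  assumes noeth: "noetherian TYPE('a::comm_ring_1)" and I: "ideal.subspace (I :: 'a set)"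
  shows "finite (colon I ` {h. maximal_annihilator I h})"
proof -
  obtain F where F: "F \<subseteq> {h. maximal_annihilator I h}" "finite F"
      "ideal.span F = ideal.span {h. maximal_annihilator I h}"
    using noetherian_finite_generators[OF noeth] by metis
  have "colon I h \<in> colon I ` F" if h: "maximal_annihilator I h" for h
  proof -
    have "h \<in> ideal.span F" unfolding F(3) using h by (intro ideal.span_base) simp
    have "a * h \<in> I" if a: "\<And>x. x \<in> F \<Longrightarrow> a * x \<in> I" for a
    proof -
      have "F \<subseteq> colon I a" using a by (simp add: colon_def mult.commute[of _ a] subset_iff)
      then have "h \<in> colon I a"
        using \<open>h \<in> ideal.span F\<close> ideal.span_minimal[OF _ ideal_colon[OF I]] by blast
      then show ?thesis by (simp add: colon_def mult.commute)
    qed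
    then have "(\<Inter>x\<in>F. colon I x) \<subseteq> colon I h" by (auto simp: colon_def)
    from prime_ideal_contains_factor[OF prime_maximal_annihilator[OF I h] F(2) ideal_colon[OF I] this]
    obtain x where "x \<in> F" "colon I x \<subseteq> colon I h" ..
    moreover have "maximal_annihilator I x" using F(1) \<open>x \<in> F\<close> by blast
    ultimately show ?thesis
      using maximal_annihilatorD(2)[of I x h] maximal_annihilatorD(1)[OF h] by blast
  qed
  then have "colon I ` {h. maximal_annihilator I h} \<subseteq> colon I ` F" by blast
  then show ?thesis using F(2) finite_subset by blast
qed

text \<open>No nonzero element of \<open>R/I\<close> is annihilated by \<open>m\<close>;
  equivalently, \<open>Hom(R/m, R/I) = 0\<close>. Over a Noetherian ring this means that
  \<open>m\<close> contains a nonzerodivisor on \<open>R/I\<close>.\<close>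
definition socle_free :: "'a::comm_ring_1 set \<Rightarrow> 'a set \<Rightarrow> bool" where
  "socle_free m I \<longleftrightarrow> (\<forall>g. (\<forall>a\<in>m. a * g \<in> I) \<longrightarrow> g \<in> I)"

lemma nonzerodivisor_imp_socle_free:
  "f \<in> m \<Longrightarrow> nonzerodivisor_mod I f \<Longrightarrow> socle_free m I"
  unfolding socle_free_def nonzerodivisor_mod_def by blast

text \<open>An element outside of the finitely many maximal annihilators of all the modules
  \<open>R/I\<close> is a nonzerodivisor on each of them. None of these primes contains
  \<open>m\<close>, because no nonzero element is annihilated by \<open>m\<close>.\<close>
lemma common_nonzerodivisor:
  assumes noeth: "noetherian TYPE('a::comm_ring_1)" and m: "ideal.subspace (m :: 'a set)"
    and fin: "finite \<I>" and \<I>: "\<forall>I\<in>\<I>. ideal.subspace I \<and> socle_free m I"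
  shows "\<exists>f\<in>m. \<forall>I\<in>\<I>. nonzerodivisor_mod I f"
proof -
  have ideals: "ideal.subspace I" and free: "socle_free m I" if "I \<in> \<I>" for I
    using \<I> that by blast+
  let ?\<P> = "\<Union>I\<in>\<I>. colon I ` {h. maximal_annihilator I h}"
  have "\<exists>f\<in>m. \<forall>P\<in>?\<P>. f \<notin> P"
  proof (rule prime_avoidance[OF _ m])
    show "finite ?\<P>" using fin finite_maximal_annihilators[OF noeth ideals] by blast
    show "prime_ideal P" if "P \<in> ?\<P>" for P
      using that prime_maximal_annihilator ideals by blast
    show "\<not> m \<subseteq> P" if P: "P \<in> ?\<P>" for P
    proof
      assume "m \<subseteq> P"
      moreover obtain I h where Ih: "I \<in> \<I>" "maximal_annihilator I h" "P = colon I h"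
        using P by blast
      ultimately have "\<forall>a\<in>m. a * h \<in> I" by (auto simp: colon_def)
      then show False
        using free[OF Ih(1)] maximal_annihilatorD(1)[OF Ih(2)] unfolding socle_free_def by blast
    qed
  qed
  then obtain f where f: "f \<in> m" "\<forall>P\<in>?\<P>. f \<notin> P" by blast
  have "g \<in> I" if I: "I \<in> \<I>" and fg: "f * g \<in> I" for I g
  proof (rule ccontr)
    assume "g \<notin> I"
    then obtain h where "maximal_annihilator I h" "colon I g \<subseteq> colon I h"
      using ex_maximal_annihilator[OF noeth ideals[OF I]] by blast
    moreover have "f \<in> colon I g" using fg by (simp add: colon_def)
    ultimately show False using f(2) I by blast
  qed
  then show ?thesis using f(1) unfolding nonzerodivisor_mod_def by blast
qed

section \<open>Depth\<close>

text \<open>A recursive form of the existence of a regular sequence of length \<open>r\<close> in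
  \<open>m\<close>. If \<open>I \<subseteq> m \<noteq> R\<close>, the ideals that occur stay
  inside \<open>m\<close>, so that all quotients are nonzero.\<close>
primrec depth_at_least :: "'a::comm_ring_1 set \<Rightarrow> nat \<Rightarrow> 'a set \<Rightarrow> bool" where
  "depth_at_least m 0 I \<longleftrightarrow> True"
| "depth_at_least m (Suc r) I \<longleftrightarrow>
     (\<exists>f\<in>m. nonzerodivisor_mod I f \<and> depth_at_least m r (adjoin I f))"

lemma regular_sequence_mod_Nil: 
  "regular_sequence_mod I [] \<longleftrightarrow> ideal.span I \<noteq> UNIV"
  by (simp add: regular_sequence_mod_def)

lemma regular_sequence_mod_Cons:
  assumes "ideal.subspace I"
  shows "regular_sequence_mod I (f # fs) \<longleftrightarrow>
    nonzerodivisor_mod I f \<and> regular_sequence_mod (adjoin I f) fs"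
proof -
  have span: "ideal.span (adjoin I f \<union> A) = ideal.span (I \<union> insert f A)" for A
    unfolding ideal.span_eq
  proof
    have "adjoin I f \<subseteq> ideal.span (I \<union> insert f A)"
      unfolding adjoin_def by (intro ideal.span_mono) auto
    then show "adjoin I f \<union> A \<subseteq> ideal.span (I \<union> insert f A)"
      using ideal.span_superset[of "I \<union> insert f A"] by blast
    have "insert f I \<subseteq> adjoin I f"
      unfolding adjoin_def by (rule ideal.span_superset)
    then show "I \<union> insert f A \<subseteq> ideal.span (adjoin I f \<union> A)"
      using ideal.span_superset[of "adjoin I f \<union> A"] by blast
  qed
  show ?thesis
    unfolding regular_sequence_mod_def
    using assms by (simp add: span All_less_Suc2 ideal.span_eq_iff[THEN iffD2] conj_assoc)
qed

lemma depth_at_least_iff_regular_sequence: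
  assumes m: "ideal.subspace m" "m \<noteq> UNIV" and "ideal.subspace I" "I \<subseteq> m"
  shows "depth_at_least m r I \<longleftrightarrow>
    (\<exists>fs. length fs = r \<and> set fs \<subseteq> m \<and> regular_sequence_mod I fs)"
  using assms(3,4)
proof (induction r arbitrary: I)
  case 0
  then have "ideal.span I \<noteq> UNIV" using m ideal.span_eq_iff by fastforce
  then show ?case by (simp add: regular_sequence_mod_Nil)
next
  case (Suc r)
  have "adjoin I f \<subseteq> m" if "f \<in> m" for f
    using adjoin_subset Suc.prems m that by blast
  then show ?case
    by (force simp: Suc.IH length_Suc_conv regular_sequence_mod_Cons[OF Suc.prems(1)])
qed

lemma depth_at_least_antimono:
  "depth_at_least m s I \<Longrightarrow> r \<le> s \<Longrightarrow> depth_at_least m r I"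
proof (induction r arbitrary: s I)
  case (Suc r)
  then show ?case by (cases s) auto
qed simp

lemma enat_le_depth_mod_iff:
  assumes "ideal.subspace m" "m \<noteq> UNIV" "ideal.subspace I" "I \<subseteq> m"
  shows "enat r \<le> depth_mod m I \<longleftrightarrow> depth_at_least m r I"
proof
  assume "depth_at_least m r I"
  then obtain fs where "length fs = r" "set fs \<subseteq> m \<and> regular_sequence_mod I fs"
    using depth_at_least_iff_regular_sequence[OF assms] by blast
  then show "enat r \<le> depth_mod m I"
    unfolding depth_mod_def by (intro SUP_upper2[of fs]) auto
next
  assume r: "enat r \<le> depth_mod m I"
  have "\<exists>fs. set fs \<subseteq> m \<and> regular_sequence_mod I fs \<and> r \<le> length fs"
  proof (cases r)
    case 0
    then have "depth_at_least m r I" by simp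
    then obtain fs where "length fs = r" "set fs \<subseteq> m \<and> regular_sequence_mod I fs"
      using depth_at_least_iff_regular_sequence[OF assms] by blast
    then show ?thesis by (intro exI[of _ fs]) simp
  next
    case (Suc r')
    then have "enat r' < depth_mod m I"
      using r by (metis Suc_ile_eq)
    then show ?thesis
      unfolding depth_mod_def less_SUP_iff using Suc by auto
  qed
  then show "depth_at_least m r I"
    using depth_at_least_iff_regular_sequence[OF assms] depth_at_least_antimono by metis
qed

section \<open>Invariance of depth modulo a nonzerodivisor\<close>

text \<open>The degree-one case of the invariance of depth: \<open>Hom(R/m, M/fM)\<close> and
  \<open>Hom(R/m, M/gM)\<close> are isomorphic for nonzerodivisors \<open>f, g \<in> m\<close> on
  \<open>M = R/I\<close>, since both are \<open>Ext\<^sup>1(R/m, M)\<close>. Concretely, the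
  isomorphism maps \<open>h\<close> to the \<open>h'\<close> with \<open>g h = h' f\<close> in
  \<open>M\<close>.\<close>
lemma socle_free_adjoin_exchange:
  assumes I: "ideal.subspace I" and "g \<in> m"
    and f: "nonzerodivisor_mod I f" and g: "nonzerodivisor_mod I g"
    and free: "socle_free m (adjoin I g)"
  shows "socle_free m (adjoin I f)"
  unfolding socle_free_def
proof (intro allI impI)
  fix h assume "\<forall>a\<in>m. a * h \<in> adjoin I f"
  then have h: "\<exists>i\<in>I. \<exists>k. a * h = i + k * f" if "a \<in> m" for a
    using that by (simp add: mem_adjoin_iff[OF I])
  obtain i h' where h': "i \<in> I" "g * h = i + h' * f"
    using h[OF \<open>g \<in> m\<close>] by blast
  have "a * h' \<in> adjoin I g" if "a \<in> m" for a
  proof -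
    obtain j u where u: "j \<in> I" "a * h = j + u * f" using h[OF \<open>a \<in> m\<close>] by blast
    have "f * (a * h' - u * g) = a * (g * h - i) - g * (a * h - j)"
      by (simp add: h'(2) u(2) algebra_simps)
    also have "\<dots> = g * j - a * i" by (simp add: algebra_simps)
    also have "\<dots> \<in> I" using u(1) h'(1) I by (simp add: ideal.subspace_diff ideal.subspace_scale)
    finally have "a * h' - u * g \<in> I" using nonzerodivisor_modD[OF f] by blast
    then show ?thesis
      unfolding mem_adjoin_iff[OF I] by (metis diff_add_cancel)
  qed
  then have "h' \<in> adjoin I g" using free unfolding socle_free_def by blast
  then obtain i' u where u: "i' \<in> I" "h' = i' + u * g" using mem_adjoin_iff[OF I] by blast
  have "g * (h - u * f) = i + f * i'" 
    by (simp add: h'(2) u(2) algebra_simps)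
  also have "\<dots> \<in> I" using u(1) h'(1) I by (simp add: ideal.subspace_add ideal.subspace_scale)
  finally have "h - u * f \<in> I" using nonzerodivisor_modD[OF g] by blast
  then show "h \<in> adjoin I f" unfolding mem_adjoin_iff[OF I] by (metis diff_add_cancel)
qed

text \<open>In a regular sequence \<open>f, g\<close> the element \<open>f\<close> stays regular
  modulo \<open>g\<close>. The other half of the exchange, that \<open>g\<close> is regular on
  \<open>R/I\<close>, may fail if the ring is not local; below \<open>g\<close> is chosen such
  that it holds.\<close>
lemma nonzerodivisor_adjoin_swap:
  assumes I: "ideal.subspace I"
    and f: "nonzerodivisor_mod I f" and g: "nonzerodivisor_mod (adjoin I f) g"
  shows "nonzerodivisor_mod (adjoin I g) f"
  unfolding nonzerodivisor_mod_def
proof (intro allI impI)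
  fix u assume "f * u \<in> adjoin I g"
  then obtain i w where w: "i \<in> I" "f * u = i + w * g" using mem_adjoin_iff[OF I] by blast
  have "g * w = - i + u * f" using w by (simp add: algebra_simps)
  then have "g * w \<in> adjoin I f"
    unfolding mem_adjoin_iff[OF I] using w(1) I ideal.subspace_neg by blast
  then have "w \<in> adjoin I f" using nonzerodivisor_modD[OF g] by blast
  then obtain j w' where w': "j \<in> I" "w = j + w' * f" using mem_adjoin_iff[OF I] by blast
  have "f * (u - w' * g) = i + g * j" using w(2) w'(2) by (simp add: algebra_simps)
  also have "\<dots> \<in> I" using w(1) w'(1) I by (simp add: ideal.subspace_add ideal.subspace_scale)
  finally have "u - w' * g \<in> I" using nonzerodivisor_modD[OF f] by blast
  then show "u \<in> adjoin I g" unfolding mem_adjoin_iff[OF I] by (metis diff_add_cancel)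
qed

locale ideal_of_noetherian_ring =
  fixes m :: "'a::comm_ring_1 set"
  assumes noetherian: "noetherian TYPE('a)"
    and ideal_m: "ideal.subspace m"
begin

lemma depth_at_least_Suc_imp_socle_free:
  "depth_at_least m (Suc r) I \<Longrightarrow> socle_free m I"
  using nonzerodivisor_imp_socle_free by auto

text \<open>By \<open>socle_free_adjoin_exchange\<close> there is a \<open>g\<close> that is
  regular on \<open>R/I\<close>, on \<open>R/(I + f)\<close> and on \<open>R/(I + f')\<close>. Two
  applications of the induction hypothesis, first to replace the next element of the sequence by
  \<open>g\<close>, then modulo \<open>g\<close> to replace \<open>f\<close> by \<open>f'\<close>,
  lead from \<open>f\<close> to \<open>f'\<close>.\<close>
lemma depth_at_least_adjoin_exchange:
  assumes "ideal.subspace I" "f \<in> m" "f' \<in> m"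
    "nonzerodivisor_mod I f" "nonzerodivisor_mod I f'"
    "depth_at_least m r (adjoin I f)"
  shows "depth_at_least m r (adjoin I f')"
  using assms
proof (induction r arbitrary: I f f')
  case (Suc r)
  note I = Suc.prems(1) and f = Suc.prems(2,4) and f' = Suc.prems(3,5)
  have free: "socle_free m (adjoin I f)"
    using Suc.prems(6) depth_at_least_Suc_imp_socle_free by blast
  moreover have "socle_free m (adjoin I f')"
    using socle_free_adjoin_exchange[OF I f(1) f'(2) f(2) free] .
  moreover have "socle_free m I" using nonzerodivisor_imp_socle_free f by blast
  ultimately obtain g where "g \<in> m" and g: "nonzerodivisor_mod I g"
      "nonzerodivisor_mod (adjoin I f) g" "nonzerodivisor_mod (adjoin I f') g"
    using common_nonzerodivisor[OF noetherian ideal_m, of "{I, adjoin I f, adjoin I f'}"] I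
    by auto
  obtain h where "h \<in> m" "nonzerodivisor_mod (adjoin I f) h"
      "depth_at_least m r (adjoin (adjoin I f) h)"
    using Suc.prems(6) by auto
  then have "depth_at_least m r (adjoin (adjoin I f) g)"
    using Suc.IH[of "adjoin I f" h g] \<open>g \<in> m\<close> g by simp
  then have "depth_at_least m r (adjoin (adjoin I g) f)" by (simp add: adjoin_commute)
  then have "depth_at_least m r (adjoin (adjoin I g) f')"
    using Suc.IH[of "adjoin I g" f f'] f f' g nonzerodivisor_adjoin_swap[OF I] by simp
  then have "depth_at_least m r (adjoin (adjoin I f') g)" by (simp add: adjoin_commute)
  then show ?case using g \<open>g \<in> m\<close> by auto
qed simp

lemma depth_at_least_Suc_iff:
  assumes "ideal.subspace I" "f \<in> m" "nonzerodivisor_mod I f"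
  shows "depth_at_least m (Suc r) I \<longleftrightarrow> depth_at_least m r (adjoin I f)"
  using assms depth_at_least_adjoin_exchange by auto

end

section \<open>The depth lemma\<close>

text \<open>In the exact sequence \<open>0 \<rightarrow> R/(L : v) \<rightarrow> R/L \<rightarrow>
  R/(L + v) \<rightarrow> 0\<close>, the kernel of multiplication by \<open>f\<close> on the
  middle term is an extension of submodules of the kernels on the outer terms.\<close>
lemma nonzerodivisor_from_colon_adjoin:
  assumes L: "ideal.subspace L"
    and J: "nonzerodivisor_mod (colon L v) f" and K: "nonzerodivisor_mod (adjoin L v) f"
  shows "nonzerodivisor_mod L f"
  unfolding nonzerodivisor_mod_def
proof (intro allI impI)
  fix u assume fu: "f * u \<in> L"
  then have "u \<in> adjoin L v" using nonzerodivisor_modD[OF K] subset_adjoin by blast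
  then obtain l w where w: "l \<in> L" "u = l + w * v" using mem_adjoin_iff[OF L] by blast
  have "(f * w) * v = f * u - f * l" by (simp add: w algebra_simps)
  also have "\<dots> \<in> L" using fu w(1) L by (simp add: ideal.subspace_diff ideal.subspace_scale)
  finally have "w \<in> colon L v"
    using nonzerodivisor_modD[OF J, of w] by (simp add: colon_def)
  then show "u \<in> L" using w L by (simp add: colon_def ideal.subspace_add)
qed

text \<open>Reduction modulo \<open>f\<close> preserves the exactness of \<open>0 \<rightarrow>
  R/(L : v) \<rightarrow> R/L \<rightarrow> R/(L + v) \<rightarrow> 0\<close>, because
  \<open>f\<close> is regular on the last term.\<close>
lemma colon_adjoin:
  assumes L: "ideal.subspace L" and K: "nonzerodivisor_mod (adjoin L v) f"
  shows "colon (adjoin L f) v = adjoin (colon L v) f"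
proof -
  note J = ideal_colon[OF L, of v]
  have "u \<in> adjoin (colon L v) f" if uv: "u * v \<in> adjoin L f" for u
  proof -
    obtain l h where h: "l \<in> L" "u * v = l + h * f" using uv mem_adjoin_iff[OF L] by blast
    have "f * h = - l + u * v" using h by (simp add: algebra_simps)
    then have "f * h \<in> adjoin L v"
      unfolding mem_adjoin_iff[OF L] using h(1) L ideal.subspace_neg by blast
    then have "h \<in> adjoin L v" using nonzerodivisor_modD[OF K] by blast
    then obtain l' h' where h': "l' \<in> L" "h = l' + h' * v" using mem_adjoin_iff[OF L] by blast
    have "(u - h' * f) * v = l + f * l'" using h(2) h'(2) by (simp add: algebra_simps)
    also have "\<dots> \<in> L" using h(1) h'(1) L by (simp add: ideal.subspace_add ideal.subspace_scale)
    finally have "u - h' * f \<in> colon L v" by (simp add: colon_def)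
    then show ?thesis unfolding mem_adjoin_iff[OF J] by (metis diff_add_cancel)
  qed
  moreover have "u * v \<in> adjoin L f" if u: "u \<in> adjoin (colon L v) f" for u
  proof -
    obtain j k where j: "j \<in> colon L v" "u = j + k * f" using u mem_adjoin_iff[OF J] by blast
    have "u * v = j * v + (k * v) * f" by (simp add: j algebra_simps)
    then show ?thesis unfolding mem_adjoin_iff[OF L] using j(1) unfolding colon_def by blast
  qed
  ultimately show ?thesis by (auto simp: colon_def)
qed

context ideal_of_noetherian_ring
begin

text \<open>A common nonzerodivisor of the outer terms of the exact sequence is regular on the
  middle term as well. Modulo this element all depths drop by one and the sequence keeps its form,
  which gives the induction step. So the depth of the middle term is at least the minimum of those
  of the outer terms.\<close>
lemma depth_at_least_from_colon_adjoin:
  assumes "ideal.subspace L" "depth_at_least m r (colon L v)" "depth_at_least m r (adjoin L v)"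
  shows "depth_at_least m r L"
  using assms
proof (induction r arbitrary: L)
  case (Suc r)
  note L = Suc.prems(1) and J = ideal_colon[OF Suc.prems(1), of v]
  obtain f where "f \<in> m" and f: "nonzerodivisor_mod (colon L v) f"
      "nonzerodivisor_mod (adjoin L v) f"
    using common_nonzerodivisor[OF noetherian ideal_m, of "{colon L v, adjoin L v}"] J
      depth_at_least_Suc_imp_socle_free Suc.prems(2,3) by (auto simp del: depth_at_least.simps)
  have "depth_at_least m r (colon (adjoin L f) v)"
    using Suc.prems(2) depth_at_least_Suc_iff[OF J \<open>f \<in> m\<close> f(1)] colon_adjoin[OF L f(2)] by simp
  moreover have "depth_at_least m r (adjoin (adjoin L f) v)"
    using Suc.prems(3) depth_at_least_Suc_iff[OF ideal_adjoin \<open>f \<in> m\<close> f(2)]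
    by (simp add: adjoin_commute)
  ultimately have "depth_at_least m r (adjoin L f)" using Suc.IH by simp
  then show ?case using \<open>f \<in> m\<close> nonzerodivisor_from_colon_adjoin[OF L f] by auto
qed simp

text \<open>The same induction, now with a common nonzerodivisor of the middle and the last term;
  it is regular on the first term, which embeds into the middle one. The bound is the part of the
  depth lemma for the first term: its depth is at least the minimum of the depth of the middle
  term and the depth of the last term plus one.\<close>
lemma depth_at_least_colon:
  assumes "ideal.subspace L" "depth_at_least m (Suc r) L" "depth_at_least m r (adjoin L v)"
  shows "depth_at_least m (Suc r) (colon L v)"
  using assms
proof (induction r arbitrary: L)
  case 0
  then show ?case using nonzerodivisor_colon by auto
next
  case (Suc r)
  note L = Suc.prems(1) and J = ideal_colon[OF Suc.prems(1), of v]
  obtain f where "f \<in> m" and f: "nonzerodivisor_mod L f" "nonzerodivisor_mod (adjoin L v) f"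
    using common_nonzerodivisor[OF noetherian ideal_m, of "{L, adjoin L v}"] L
      depth_at_least_Suc_imp_socle_free Suc.prems(2,3) by (auto simp del: depth_at_least.simps)
  have "depth_at_least m (Suc r) (adjoin L f)"
    using Suc.prems(2) depth_at_least_Suc_iff[OF L \<open>f \<in> m\<close> f(1)] by blast
  moreover have "depth_at_least m r (adjoin (adjoin L f) v)"
    using Suc.prems(3) depth_at_least_Suc_iff[OF ideal_adjoin \<open>f \<in> m\<close> f(2)]
    by (simp add: adjoin_commute)
  ultimately have "depth_at_least m (Suc r) (colon (adjoin L f) v)"
    using Suc.IH by simp
  then have "depth_at_least m (Suc r) (adjoin (colon L v) f)"
    using colon_adjoin[OF L f(2)] by simp
  then show ?case
    using depth_at_least_Suc_iff[OF J \<open>f \<in> m\<close> nonzerodivisor_colon[OF f(1)]] by blast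
qed

end

section \<open>Depth and surjections\<close>

text \<open>The quotients by \<open>I\<close> and by its preimage under \<open>\<phi>\<close> are
  isomorphic, and a surjection maps \<open>m\<close>, the preimage of \<open>m'\<close>, onto
  \<open>m'\<close>. So regular sequences can be mapped forward and lifted.\<close>
lemma depth_at_least_vimage:
  fixes \<phi> :: "'a::comm_ring_1 \<Rightarrow> 'b::comm_ring_1"
  assumes add: "\<And>x y. \<phi> (x + y) = \<phi> x + \<phi> y" and mult: "\<And>x y. \<phi> (x * y) = \<phi> x * \<phi> y"
    and surj: "surj \<phi>" and m: "\<phi> -` m' = m"
    and I: "ideal.subspace I"
  shows "depth_at_least m r (\<phi> -` I) \<longleftrightarrow> depth_at_least m' r I"
  using I
proof (induction r arbitrary: I)
  case (Suc r)
  note I = Suc.prems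
  have I': "ideal.subspace (\<phi> -` I)"
  proof -
    have "\<phi> 0 = 0" using add[of 0 0] by simp
    then show ?thesis
      using I unfolding ideal.subspace_def by (simp add: add mult)
  qed
  have diff: "\<phi> (x - y) = \<phi> x - \<phi> y" for x y
    using add[of "x - y" y] by (simp add: algebra_simps)
  have adj: "adjoin (\<phi> -` I) f = \<phi> -` adjoin I (\<phi> f)" for f
  proof -
    have "x \<in> adjoin (\<phi> -` I) f \<longleftrightarrow> (\<exists>k. \<phi> x - \<phi> k * \<phi> f \<in> I)" for x
      using I' by (simp add: adjoin_def ideal.span_breakdown_eq ideal.span_eq_iff[THEN iffD2] diff mult)
    also have "\<dots> x \<longleftrightarrow> (\<exists>k. \<phi> x - k * \<phi> f \<in> I)" for x
      using surj by (metis surjD)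
    also have "\<dots> x \<longleftrightarrow> \<phi> x \<in> adjoin I (\<phi> f)" for x
      using I by (simp add: adjoin_def ideal.span_breakdown_eq ideal.span_eq_iff[THEN iffD2])
    finally show ?thesis by blast
  qed
  have nzd: "nonzerodivisor_mod (\<phi> -` I) f \<longleftrightarrow> nonzerodivisor_mod I (\<phi> f)" for f
    unfolding nonzerodivisor_mod_def using surj by (auto simp: mult) (metis surjD)
  have "depth_at_least m (Suc r) (\<phi> -` I) \<longleftrightarrow>
      (\<exists>f. \<phi> f \<in> m' \<and> nonzerodivisor_mod I (\<phi> f) \<and> depth_at_least m' r (adjoin I (\<phi> f)))"
    using m by (auto simp: nzd adj Suc.IH)
  also have "\<dots> \<longleftrightarrow> depth_at_least m' (Suc r) I"
    using surj by (simp add: Bex_def) (metis surjD)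
  finally show ?case .
qed simp

section \<open>Polynomial rings over a field are Noetherian\<close>

abbreviation lookup where "lookup \<equiv> Poly_Mapping.lookup"
abbreviation keys where "keys \<equiv> Poly_Mapping.keys"
abbreviation single where "single \<equiv> Poly_Mapping.single"

lemma incseq_subsequence:
  fixes s :: "nat \<Rightarrow> nat"
  shows "\<exists>r. strict_mono r \<and> incseq (\<lambda>n. s (r n))"
proof -
  obtain r where r: "strict_mono r" "monoseq (\<lambda>n. s (r n))"
    using seq_monosub by blast
  show ?thesis
  proof (cases "incseq (\<lambda>n. s (r n))")
    case False
    then have dec: "decseq (\<lambda>n. s (r n))" using r(2) monoseq_iff by blast
    obtain N where N: "\<And>n. s (r N) \<le> s (r n)"
      using ex_has_least_nat[of "\<lambda>n. True" _ "\<lambda>n. s (r n)"] by blast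
    have "s (r (N + n)) = s (r N)" for n
      using N[of "N + n"] decseqD[OF dec, of N "N + n"] by simp
    moreover have "strict_mono (\<lambda>n. r (N + n))"
      using r(1) by (simp add: strict_mono_def)
    ultimately show ?thesis by (intro exI[of _ "\<lambda>n. r (N + n)"]) (simp add: incseq_def)
  qed (use r in blast)
qed

text \<open>A sequence of exponent vectors has a subsequence that is increasing in every
  coordinate: pass to a monotone subsequence for one coordinate after the other.\<close>
lemma dickson:
  fixes t :: "nat \<Rightarrow> 'v::finite \<Rightarrow> nat"
  shows "\<exists>i j. i < j \<and> t i \<le> t j"
proof -
  have "\<exists>r. strict_mono r \<and> (\<forall>x\<in>A. incseq (\<lambda>n. t (r n) x))" if "finite A" for A
    using that
  proof (induction A rule: finite_induct)
    case empty
    show ?case using strict_mono_id by auto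
  next
    case (insert x A)
    then obtain r where r: "strict_mono r" "\<forall>y\<in>A. incseq (\<lambda>n. t (r n) y)" by blast
    obtain r' where r': "strict_mono r'" "incseq (\<lambda>n. t (r (r' n)) x)"
      using incseq_subsequence[of "\<lambda>n. t (r n) x"] by blast
    have "incseq (\<lambda>n. t (r (r' n)) y)" if "y \<in> A" for y
      using r(2) that r'(1) by (auto simp: incseq_def strict_mono_less_eq)
    then show ?case
      using r r' strict_mono_o[OF r(1) r'(1)] by (intro exI[of _ "r \<circ> r'"]) (auto simp: comp_def)
  qed
  from this[of UNIV] obtain r where r: "strict_mono r" "\<And>x. incseq (\<lambda>n. t (r n) x)" by auto
  then have "t (r 0) \<le> t (r 1)" by (auto simp: le_fun_def incseq_def)
  then show ?thesis using r(1) by (metis strict_mono_less zero_less_one)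
qed

lemma lookup_le_iff:
  fixes a u :: "'v \<Rightarrow>\<^sub>0 nat"
  shows "lookup a \<le> lookup u \<longleftrightarrow> (\<exists>s. u = s + a)"
proof
  assume "lookup a \<le> lookup u"
  then have "u = (u - a) + a"
    by (intro poly_mapping_eqI) (simp add: lookup_add lookup_minus le_fun_def)
  then show "\<exists>s. u = s + a" by blast
qed (auto simp: le_fun_def lookup_add)

definition monomial_order :: "(('v \<Rightarrow>\<^sub>0 nat) \<Rightarrow> ('v \<Rightarrow>\<^sub>0 nat) \<Rightarrow> bool) \<Rightarrow> bool" where
  "monomial_order lt \<longleftrightarrow> transp lt \<and> irreflp lt \<and> totalp lt \<and>
     (\<forall>s t u. lt s t \<longrightarrow> lt (u + s) (u + t)) \<and> (\<forall>s. s \<noteq> 0 \<longrightarrow> lt 0 s)"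

text \<open>The lexicographic order for an arbitrary numbering \<open>e\<close> of the
  variables.\<close>
lemma ex_monomial_order: "\<exists>lt :: ('v::finite \<Rightarrow>\<^sub>0 nat) \<Rightarrow> _. monomial_order lt"
proof -
  obtain e :: "'v \<Rightarrow> nat" where e: "inj e"
    using finite_imp_inj_to_nat_seg[of "UNIV :: 'v set"] by auto
  define lt where "lt s t \<longleftrightarrow>
    (\<exists>x. lookup s x < lookup t x \<and> (\<forall>y. e y < e x \<longrightarrow> lookup s y = lookup t y))"
    for s t :: "'v \<Rightarrow>\<^sub>0 nat"
  have total: "lt s t \<or> lt t s" if "s \<noteq> t" for s t
  proof -
    have "\<exists>x. lookup s x \<noteq> lookup t x" using that by (meson poly_mapping_eqI)
    then obtain x where "lookup s x \<noteq> lookup t x"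
        "\<And>y. lookup s y \<noteq> lookup t y \<Longrightarrow> e x \<le> e y"
      using ex_has_least_nat[of "\<lambda>x. lookup s x \<noteq> lookup t x" _ e] by blast
    then show ?thesis unfolding lt_def by (metis leD linorder_neqE_nat)
  qed
  have trans: "lt s u" if "lt s t" "lt t u" for s t u
  proof -
    obtain x where x: "lookup s x < lookup t x" "\<forall>z. e z < e x \<longrightarrow> lookup s z = lookup t z"
      using \<open>lt s t\<close> unfolding lt_def by blast
    obtain y where y: "lookup t y < lookup u y" "\<forall>z. e z < e y \<longrightarrow> lookup t z = lookup u z"
      using \<open>lt t u\<close> unfolding lt_def by blast
    consider "e x < e y" | "e y < e x" | "x = y"
      using e by (metis injD linorder_neqE_nat)
    then show ?thesis
    proof cases
      case 1
      then show ?thesis unfolding lt_def using x y by (intro exI[of _ x]) auto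
    next
      case 2
      then show ?thesis unfolding lt_def using x y by (intro exI[of _ y]) auto
    next
      case 3
      then show ?thesis unfolding lt_def using x y by (intro exI[of _ x]) auto
    qed
  qed
  have pos: "lt 0 s" if "s \<noteq> 0" for s
    using total[OF that] by (auto simp: lt_def)
  have irrefl: "\<not> lt s s" and add: "lt s t \<Longrightarrow> lt (u + s) (u + t)" for s t u
    by (auto simp: lt_def lookup_add)
  have "monomial_order lt"
    unfolding monomial_order_def
  proof (intro conjI allI impI)
    show "transp lt" by (rule transpI) (rule trans)
    show "irreflp lt" by (rule irreflpI) (rule irrefl)
    show "totalp lt" by (rule totalpI) (use total in blast)
  qed (rule add pos, assumption)+
  then show ?thesis by blast
qed

text \<open>In a descending sequence Dickson's lemma gives an earlier term that divides a later
  one and hence is not larger than it.\<close>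
lemma wfp_monomial_order:
  fixes lt :: "('v::finite \<Rightarrow>\<^sub>0 nat) \<Rightarrow> _"
  assumes "monomial_order lt"
  shows "wfp lt"
proof -
  have "\<not> (\<exists>t. \<forall>i. (t (Suc i), t i) \<in> {(a, b). lt a b})"
  proof
    assume "\<exists>t. \<forall>i. (t (Suc i), t i) \<in> {(a, b). lt a b}"
    then obtain t where t: "\<And>i. lt (t (Suc i)) (t i)" by auto
    have desc: "lt (t j) (t i)" if "i < j" for i j
      using that
    proof (induction j)
      case (Suc j)
      then show ?case
        using t[of j] assms unfolding monomial_order_def by (metis less_antisym transpE)
    qed simp
    obtain i j where "i < j" "lookup (t i) \<le> lookup (t j)"
      using dickson[of "\<lambda>i. lookup (t i)"] by blast
    then obtain s where s: "t j = s + t i" unfolding lookup_le_iff by blast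
    have "lt (t i) (t j) \<or> t i = t j"
    proof (cases "s = 0")
      case False
      then have "lt (t i + 0) (t i + s)" using assms unfolding monomial_order_def by blast
      then show ?thesis using s by (simp add: add.commute)
    qed (simp add: s)
    then show False
      using desc[OF \<open>i < j\<close>] assms unfolding monomial_order_def by (metis irreflpD transpE)
  qed
  then show ?thesis unfolding wfp_def wf_iff_no_infinite_down_chain .
qed

lemma wfp_minimal:
  assumes "wfp lt" and "P t"
  shows "\<exists>t. P t \<and> (\<forall>u. lt u t \<longrightarrow> \<not> P u)"
proof (rule ccontr)
  assume *: "\<not> ?thesis"
  have "\<not> P u" for u
    using \<open>wfp lt\<close> by (induction u rule: wfp_induct_rule) (use * in blast)
  then show False using \<open>P t\<close> by blast
qed

lemma lookup_single_mult:
  "lookup (single s c * p) (s + t) = c * lookup p (t :: 'a::cancel_comm_monoid_add)"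
  by (simp add: lookup_mult lookup_single when_mult)

text \<open>The exponent \<open>t\<close> of the leading monomial of \<open>p\<close>.\<close>
definition leads :: "('a \<Rightarrow> 'a \<Rightarrow> bool) \<Rightarrow> ('a \<Rightarrow>\<^sub>0 'k::zero) \<Rightarrow> 'a \<Rightarrow> bool" where
  "leads lt p t \<longleftrightarrow> t \<in> keys p \<and> (\<forall>u\<in>keys p. u \<noteq> t \<longrightarrow> lt u t)"

lemma ex_leads:
  assumes "monomial_order lt" "p \<noteq> 0"
  shows "\<exists>t. leads lt p t"
  using Finite_Set.bex_greatest_element[of "keys p" lt] assms
  unfolding leads_def monomial_order_def
  by (metis finite_keys keys_eq_empty totalp_on_subset subset_UNIV transp_on_subset)

lemma leading_term_cancel:
  fixes p q :: "('v, 'k::field) mpoly"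
  assumes order: "monomial_order lt" and p: "leads lt p t" and q: "leads lt q (s + t)"
    and u: "u \<in> keys (q - single s (lookup q (s + t) / lookup p t) * p)"
  shows "lt u (s + t)"
proof -
  let ?c = "lookup q (s + t) / lookup p t"
  have "lookup p t \<noteq> 0" using p unfolding leads_def in_keys_iff by blast
  then have "lookup (q - single s ?c * p) (s + t) = 0"
    by (simp add: lookup_minus lookup_single_mult)
  then have "u \<noteq> s + t" using u unfolding in_keys_iff by blast
  have "u \<in> keys q \<or> u \<in> keys (single s ?c * p)"
    using u by (auto simp: in_keys_iff lookup_minus)
  then show ?thesis
  proof
    assume "u \<in> keys q"
    then show ?thesis using q \<open>u \<noteq> s + t\<close> unfolding leads_def by blast
  next
    assume "u \<in> keys (single s ?c * p)"
    then obtain w where w: "u = s + w" "w \<in> keys p"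
      using keys_mult[of "single s ?c" p] by (auto split: if_splits)
    then have "w \<noteq> t" using \<open>u \<noteq> s + t\<close> by blast
    then have "lt w t" using p w(2) unfolding leads_def by blast
    then show ?thesis using order w(1) unfolding monomial_order_def by blast
  qed
qed

text \<open>In a strictly ascending chain of ideals \<open>I i\<close>, choose \<open>p i \<in> I
  (i + 1) - I i\<close> with the smallest possible leading monomial. By Dickson's lemma the
  leading monomial of some \<open>p i\<close> divides that of \<open>p j\<close> with \<open>i <
  j\<close>. Cancelling the leading term of \<open>p j\<close> with a multiple of \<open>p i \<in>
  I j\<close> contradicts the choice of \<open>p j\<close>.\<close>
theorem noetherian_mpoly: "noetherian TYPE(('v::finite, 'k::field) mpoly)"
proof -
  obtain lt :: "('v \<Rightarrow>\<^sub>0 nat) \<Rightarrow> ('v \<Rightarrow>\<^sub>0 nat) \<Rightarrow> bool" where order: "monomial_order lt"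
    using ex_monomial_order by blast
  have no_chain: False if I: "\<And>i. ideal.subspace (I i)" "\<And>i. I i \<subset> I (Suc i)"
    for I :: "nat \<Rightarrow> ('v, 'k) mpoly set"
  proof -
    define Q where "Q i p t \<longleftrightarrow> p \<in> I (Suc i) - I i \<and> leads lt p t" for i p t
    have "\<exists>p t. Q i p t \<and> (\<forall>q u. Q i q u \<longrightarrow> \<not> lt u t)" for i
    proof -
      obtain p where p: "p \<in> I (Suc i) - I i" using I(2)[of i] by blast
      then have "p \<noteq> 0" using ideal.subspace_0[OF I(1)] by blast
      then obtain t where "Q i p t" using ex_leads[OF order] p unfolding Q_def by blast
      then have "\<exists>p. Q i p t" ..
      from wfp_minimal[OF wfp_monomial_order[OF order], of "\<lambda>t. \<exists>p. Q i p t", OF this]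
      obtain t where t0: "\<exists>p. Q i p t" and t: "\<forall>u. lt u t \<longrightarrow> \<not> (\<exists>p. Q i p u)" by blast
      from t0 obtain p where "Q i p t" ..
      then show ?thesis using t by (intro exI[of _ p] exI[of _ t]) blast
    qed
    then obtain p t where Q: "\<And>i. Q i (p i) (t i)" and min: "\<And>i q u. Q i q u \<Longrightarrow> \<not> lt u (t i)"
      by metis
    have p: "p i \<in> I (Suc i)" "p i \<notin> I i" "leads lt (p i) (t i)" for i
      using Q[of i] unfolding Q_def by blast+
    obtain i j where "i < j" "lookup (t i) \<le> lookup (t j)"
      using dickson[of "\<lambda>i. lookup (t i)"] by blast
    then obtain s where s: "t j = s + t i" unfolding lookup_le_iff by blast
    define r where "r = single s (lookup (p j) (s + t i) / lookup (p i) (t i)) * p i"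
    have "p i \<in> I j"
      using p(1)[of i] lift_Suc_mono_le[of I "Suc i" j] I(2) \<open>i < j\<close> by (auto simp: Suc_le_eq)
    then have "r \<in> I j" unfolding r_def by (rule ideal.subspace_scale[OF I(1)])
    then have "p j - r \<notin> I j"
      using p(2)[of j] ideal.subspace_add[OF I(1), of "p j - r" j r] by auto
    moreover have "p j - r \<in> I (Suc j)"
      using \<open>r \<in> I j\<close> I(2)[of j] p(1)[of j] by (intro ideal.subspace_diff[OF I(1)]) auto
    ultimately have no_lead: "\<not> lt u (t j)" if "leads lt (p j - r) u" for u
      using min[of j "p j - r" u] that unfolding Q_def by blast
    have "p j - r \<noteq> 0" using \<open>p j - r \<notin> I j\<close> ideal.subspace_0[OF I(1)] by metis
    then obtain u where u: "leads lt (p j - r) u" using ex_leads[OF order] by blast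
    have "lt u (s + t i)"
    proof (rule leading_term_cancel[OF order p(3)])
      show "leads lt (p j) (s + t i)" using p(3)[of j] s by simp
      show "u \<in> keys (p j - single s (lookup (p j) (s + t i) / lookup (p i) (t i)) * p i)"
        using u unfolding leads_def r_def by blast
    qed
    then show False using no_lead[OF u] s by simp
  qed
  show ?thesis
    unfolding noetherian_def wf_iff_no_infinite_down_chain
  proof
    let ?R = "{(J, I :: ('v, 'k) mpoly set). ideal.subspace I \<and> ideal.subspace J \<and> I \<subset> J}"
    assume "\<exists>I. \<forall>i. (I (Suc i), I i) \<in> ?R"
    then obtain I where I: "\<forall>i. (I (Suc i), I i) \<in> ?R" ..
    have "ideal.subspace (I i)" "I i \<subset> I (Suc i)" for i
      using I[rule_format, of i] by blast+
    then show False by (rule no_chain)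
  qed
qed

section \<open>Monomial ideals\<close>

definition monomial_ideal :: "('v \<Rightarrow>\<^sub>0 nat) set \<Rightarrow> ('v, 'k::field) mpoly set" where
  "monomial_ideal A = ideal.span ((\<lambda>t. single t 1) ` A)"

lemma ideal_monomial_ideal [simp]: "ideal.subspace (monomial_ideal A)"
  by (simp add: monomial_ideal_def)

lemma sum_single: "(\<Sum>u\<in>keys p. single u (lookup p u)) = p"
  by (rule poly_mapping_eqI)
     (simp add: lookup_sum lookup_single when_def in_keys_iff sum.delta')

lemma mem_monomial_ideal_iff:
  fixes p :: "('v, 'k::field) mpoly"
  shows "p \<in> monomial_ideal A \<longleftrightarrow> (\<forall>u\<in>keys p. \<exists>a\<in>A. lookup a \<le> lookup u)"
proof
  let ?S = "{p :: ('v, 'k) mpoly. \<forall>u\<in>keys p. \<exists>a\<in>A. lookup a \<le> lookup u}"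
  have "ideal.subspace ?S"
  proof (rule ideal.subspaceI)
    show "p + q \<in> ?S" if "p \<in> ?S" "q \<in> ?S" for p q :: "('v, 'k) mpoly"
      using that keys_add[of p q] by blast
    show "c * p \<in> ?S" if p: "p \<in> ?S" for c p :: "('v, 'k) mpoly"
    proof -
      have "\<exists>a\<in>A. lookup a \<le> lookup u" if u: "u \<in> keys (c * p)" for u
      proof -
        obtain s w where w: "w \<in> keys p" "u = s + w"
          using keys_mult[of c p] u by blast
        then obtain a where "a \<in> A" "lookup a \<le> lookup w" using p by blast
        then show ?thesis using w(2) by (auto simp: le_fun_def lookup_add intro: trans_le_add2)
      qed
      then show ?thesis by blast
    qed
  qed simp
  moreover have "(\<lambda>t. single t 1) ` A \<subseteq> ?S" by auto
  ultimately have "monomial_ideal A \<subseteq> ?S"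
    unfolding monomial_ideal_def by (intro ideal.span_minimal)
  then show "p \<in> monomial_ideal A \<Longrightarrow> \<forall>u\<in>keys p. \<exists>a\<in>A. lookup a \<le> lookup u" by blast
next
  assume p: "\<forall>u\<in>keys p. \<exists>a\<in>A. lookup a \<le> lookup u"
  have "single u (lookup p u) \<in> monomial_ideal A" if u: "u \<in> keys p" for u
  proof -
    obtain a where "a \<in> A" "lookup a \<le> lookup u" using p u by blast
    then obtain s where "u = s + a" using lookup_le_iff by blast
    then have "single u (lookup p u) = single s (lookup p u) * single a 1"
      by (simp add: mult_single)
    also have "\<dots> \<in> monomial_ideal A"
      unfolding monomial_ideal_def using \<open>a \<in> A\<close>
      by (intro ideal.span_scale ideal.span_base) blast
    finally show ?thesis .
  qed
  then have "(\<Sum>u\<in>keys p. single u (lookup p u)) \<in> monomial_ideal A"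
    by (intro ideal.subspace_sum) simp
  then show "p \<in> monomial_ideal A" by (simp add: sum_single)
qed

lemma adjoin_monomial_ideal:
  "adjoin (monomial_ideal A) (single t 1) = monomial_ideal (insert t A)"
proof
  show "adjoin (monomial_ideal A) (single t 1) \<subseteq> monomial_ideal (insert t A)"
    unfolding monomial_ideal_def
    by (intro adjoin_subset ideal.span_mono ideal.span_base) auto
  show "monomial_ideal (insert t A) \<subseteq> adjoin (monomial_ideal A) (single t 1)"
    unfolding monomial_ideal_def adjoin_def
    by (intro ideal.span_minimal) (auto intro: ideal.span_base)
qed

lemma keys_mult_monomial:
  fixes p :: "('v, 'k::field) mpoly"
  shows "keys (p * single t 1) = (\<lambda>u. t + u) ` keys p"
proof
  show "keys (p * single t 1) \<subseteq> (\<lambda>u. t + u) ` keys p"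
    using keys_mult[of p "single t 1"] by (auto simp: add.commute)
  show "(\<lambda>u. t + u) ` keys p \<subseteq> keys (p * single t 1)"
    by (auto simp: in_keys_iff lookup_single_mult mult.commute[of p])
qed

lemma irrelevant_ideal_monomial:
  "(irrelevant_ideal :: ('v, 'k::field) mpoly set) = monomial_ideal (range (\<lambda>x. single x 1))"
  unfolding irrelevant_ideal_def monomial_ideal_def
  by (simp add: image_image var_def[abs_def])

lemma mem_irrelevant_ideal_iff: "p \<in> irrelevant_ideal \<longleftrightarrow> lookup p 0 = 0"
proof -
  have "(\<exists>x. lookup (single x (1::nat)) \<le> lookup u) \<longleftrightarrow> u \<noteq> 0" for u :: "'v \<Rightarrow>\<^sub>0 nat"
  proof
    assume "u \<noteq> 0"
    then obtain x where "lookup u x \<noteq> 0" by (metis poly_mapping_eqI lookup_zero)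
    then have "lookup (single x (1::nat)) \<le> lookup u"
      by (auto simp: le_fun_def lookup_single when_def)
    then show "\<exists>x. lookup (single x (1::nat)) \<le> lookup u" ..
  qed (auto simp: le_fun_def lookup_single when_def split: if_splits)
  then have "p \<in> irrelevant_ideal \<longleftrightarrow> 0 \<notin> keys p"
    unfolding irrelevant_ideal_monomial mem_monomial_ideal_iff by auto
  then show ?thesis by (simp add: in_keys_iff)
qed

lemma ideal_irrelevant_ideal [simp]: "ideal.subspace irrelevant_ideal"
  by (simp add: irrelevant_ideal_def)

lemma irrelevant_ideal_proper: "irrelevant_ideal \<noteq> UNIV"
  using mem_irrelevant_ideal_iff[of 1] by auto

lemma monomial_ideal_subset_irrelevant_ideal:
  assumes "0 \<notin> A"
  shows "monomial_ideal A \<subseteq> irrelevant_ideal"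
  unfolding monomial_ideal_def
proof (rule ideal.span_minimal)
  show "(\<lambda>t. single t 1) ` A \<subseteq> irrelevant_ideal"
    using assms by (auto simp: mem_irrelevant_ideal_iff lookup_single when_def)
qed simp

lemma enat_le_depth_quot_iff:
  assumes "0 \<notin> A"
  shows "enat r \<le> depth_quot (monomial_ideal A :: ('v, 'k::field) mpoly set) \<longleftrightarrow>
    depth_at_least irrelevant_ideal r (monomial_ideal A :: ('v, 'k) mpoly set)"
  unfolding depth_quot_def
  by (rule enat_le_depth_mod_iff[OF ideal_irrelevant_ideal irrelevant_ideal_proper
        ideal_monomial_ideal monomial_ideal_subset_irrelevant_ideal[OF assms]])

section \<open>Adjoining a variable\<close>

text \<open>The variables of \<open>S = R[v]\<close> are \<open>Some x\<close>, for the variables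
  \<open>x\<close> of \<open>R\<close>, and \<open>v = None\<close>.\<close>
definition embed_exponent :: "('v::finite \<Rightarrow>\<^sub>0 nat) \<Rightarrow> ('v option \<Rightarrow>\<^sub>0 nat)" where
  "embed_exponent t = Abs_poly_mapping (case_option 0 (lookup t))"

lemma lookup_embed_exponent:
  "lookup (embed_exponent t) = case_option 0 (lookup t)"
  unfolding embed_exponent_def by (rule lookup_Abs_poly_mapping) simp

lemma le_option_iff:
  "(f :: 'v option \<Rightarrow> nat) \<le> g \<longleftrightarrow> f None \<le> g None \<and> (\<forall>x. f (Some x) \<le> g (Some x))"
  unfolding le_fun_def using option.exhaust by metis

lemma eq_option_exponent_iff:
  "(s :: 'v option \<Rightarrow>\<^sub>0 nat) = t \<longleftrightarrow>
    lookup s None = lookup t None \<and> (\<forall>x. lookup s (Some x) = lookup t (Some x))"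
  unfolding poly_mapping_eq_iff fun_eq_iff using option.exhaust by metis

lemma inj_embed_exponent: "inj embed_exponent"
  by (rule injI) (simp add: eq_option_exponent_iff lookup_embed_exponent poly_mapping_eqI)

lemma embed_exponent_add: "embed_exponent (s + t) = embed_exponent s + embed_exponent t"
  by (simp add: eq_option_exponent_iff lookup_embed_exponent lookup_add)

lemma embed_exponent_zero [simp]: "embed_exponent 0 = 0"
  by (simp add: eq_option_exponent_iff lookup_embed_exponent)

lemma embed_exponent_single: "embed_exponent (single x n) = single (Some x) n"
  by (simp add: eq_option_exponent_iff lookup_embed_exponent lookup_single when_def)

lemma range_embed_exponent: "u \<in> range embed_exponent \<longleftrightarrow> lookup u None = 0"
proof
  assume u: "lookup u None = 0"
  have "embed_exponent (Poly_Mapping.map_key Some u) = u"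
    using u by (simp add: eq_option_exponent_iff lookup_embed_exponent map_key.rep_eq)
  then show "u \<in> range embed_exponent" by (metis rangeI)
qed (auto simp: lookup_embed_exponent)

text \<open>The ring homomorphism from \<open>R[v]\<close> to \<open>R\<close> that maps
  \<open>v\<close> to \<open>0\<close>: it keeps the terms without \<open>v\<close>.\<close>
definition kill_new_variable :: "('v::finite option, 'k::field) mpoly \<Rightarrow> ('v, 'k) mpoly" where
  "kill_new_variable = Poly_Mapping.map_key embed_exponent"

lemma lookup_kill_new_variable: "lookup (kill_new_variable p) t = lookup p (embed_exponent t)"
  unfolding kill_new_variable_def by (simp add: map_key.rep_eq inj_embed_exponent)

lemma kill_new_variable_add:
  "kill_new_variable (p + q) = kill_new_variable p + kill_new_variable q"
  by (rule poly_mapping_eqI) (simp add: lookup_kill_new_variable lookup_add)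

lemma kill_new_variable_sum:
  "kill_new_variable (sum f A) = (\<Sum>x\<in>A. kill_new_variable (f x))"
  by (rule poly_mapping_eqI) (simp add: lookup_kill_new_variable lookup_sum)

lemma kill_new_variable_single:
  "kill_new_variable (single (embed_exponent t) c) = single t c"
  by (rule poly_mapping_eqI)
     (simp add: lookup_kill_new_variable lookup_single inj_eq[OF inj_embed_exponent])

lemma kill_new_variable_single_eq_0:
  "lookup u None \<noteq> 0 \<Longrightarrow> kill_new_variable (single u c) = 0"
  by (intro poly_mapping_eqI)
     (auto simp: lookup_kill_new_variable lookup_single when_def lookup_embed_exponent)

lemma kill_new_variable_mult:
  "kill_new_variable (p * q) = kill_new_variable p * kill_new_variable q"
proof -
  have single: "kill_new_variable (single u a * single w b) =
      kill_new_variable (single u a) * kill_new_variable (single w b)" for u w and a b :: 'b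
  proof (cases "lookup u None = 0 \<and> lookup w None = 0")
    case True
    obtain s where "u = embed_exponent s" using True range_embed_exponent[of u] by blast
    moreover obtain t where "w = embed_exponent t" using True range_embed_exponent[of w] by blast
    ultimately show ?thesis
      by (simp add: mult_single kill_new_variable_single flip: embed_exponent_add)
  next
    case False
    then show ?thesis
      by (auto simp: mult_single kill_new_variable_single_eq_0 lookup_add)
  qed
  have "kill_new_variable (p * q) = kill_new_variable
      ((\<Sum>u\<in>keys p. single u (lookup p u)) * (\<Sum>w\<in>keys q. single w (lookup q w)))"
    by (simp add: sum_single)
  also have "\<dots> = kill_new_variable (\<Sum>u\<in>keys p. single u (lookup p u)) *
      kill_new_variable (\<Sum>w\<in>keys q. single w (lookup q w))"
    by (simp only: sum_product kill_new_variable_sum single)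
  finally show ?thesis by (simp add: sum_single)
qed

lemma surj_kill_new_variable: "surj kill_new_variable"
proof -
  have "kill_new_variable (\<Sum>t\<in>keys p. single (embed_exponent t) (lookup p t)) = p" for p :: "('a, 'b) mpoly"
    by (simp add: kill_new_variable_sum kill_new_variable_single sum_single)
  then show ?thesis by (rule surjI)
qed

lemma vimage_irrelevant_ideal: "kill_new_variable -` irrelevant_ideal = irrelevant_ideal"
  by (auto simp: mem_irrelevant_ideal_iff lookup_kill_new_variable)

lemma mem_vimage_monomial_ideal_iff:
  "p \<in> kill_new_variable -` monomial_ideal A \<longleftrightarrow>
    (\<forall>t. embed_exponent t \<in> keys p \<longrightarrow> (\<exists>a\<in>A. lookup a \<le> lookup t))"
  by (simp add: mem_monomial_ideal_iff in_keys_iff lookup_kill_new_variable Ball_def)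

definition new_exponent :: "'v option \<Rightarrow>\<^sub>0 nat" where
  "new_exponent = single None 1"

lemma lookup_new_exponent: "lookup new_exponent x = (1 when x = None)"
  by (simp add: new_exponent_def lookup_single eq_commute)

lemma new_exponent_le_iff: "lookup new_exponent \<le> lookup u \<longleftrightarrow> lookup u None \<noteq> 0"
  by (auto simp: le_option_iff lookup_new_exponent)

text \<open>The exponents of generators of \<open>I S + v J S\<close>, if \<open>A\<close> and
  \<open>B\<close> are the exponents of generators of monomial ideals \<open>I\<close> and
  \<open>J\<close> of \<open>R\<close>.\<close>
definition cone_exponents :: "('v::finite \<Rightarrow>\<^sub>0 nat) set \<Rightarrow> ('v \<Rightarrow>\<^sub>0 nat) set \<Rightarrow> ('v option \<Rightarrow>\<^sub>0 nat) set" where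
  "cone_exponents A B = embed_exponent ` A \<union> (\<lambda>b. new_exponent + embed_exponent b) ` B"

lemma embed_exponent_le_iff:
  "lookup (embed_exponent a) \<le> lookup u \<longleftrightarrow> (\<forall>x. lookup a x \<le> lookup u (Some x))"
  by (simp add: le_option_iff lookup_embed_exponent)

lemma new_plus_embed_exponent_le_iff:
  "lookup (new_exponent + embed_exponent a) \<le> lookup u \<longleftrightarrow>
    lookup u None \<noteq> 0 \<and> (\<forall>x. lookup a x \<le> lookup u (Some x))"
  by (auto simp: le_option_iff lookup_add lookup_embed_exponent lookup_new_exponent)

text \<open>That is, \<open>S/(L + v) = R/I\<close> for \<open>L = I S + v J S\<close>.\<close>
lemma adjoin_new_variable:
  "adjoin (monomial_ideal (cone_exponents A B)) (single new_exponent 1) =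
    kill_new_variable -` (monomial_ideal A :: ('v::finite, 'k::field) mpoly set)"
proof -
  have "(\<exists>a\<in>insert new_exponent (cone_exponents A B). lookup a \<le> lookup u) \<longleftrightarrow>
      lookup u None \<noteq> 0 \<or> (\<exists>a\<in>A. \<forall>x. lookup a x \<le> lookup u (Some x))" for u
    unfolding cone_exponents_def
    by (auto simp: bex_Un new_exponent_le_iff embed_exponent_le_iff new_plus_embed_exponent_le_iff)
  moreover have "(\<forall>u\<in>U. lookup u None \<noteq> 0 \<or> (\<exists>a\<in>A. \<forall>x. lookup a x \<le> lookup u (Some x))) \<longleftrightarrow>
      (\<forall>t. embed_exponent t \<in> U \<longrightarrow> (\<exists>a\<in>A. lookup a \<le> lookup t))" for U
  proof -
    have "(\<forall>u\<in>U. lookup u None \<noteq> 0 \<or> P u) \<longleftrightarrow> (\<forall>t. embed_exponent t \<in> U \<longrightarrow> P (embed_exponent t))" for P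
    proof
      show "\<forall>t. embed_exponent t \<in> U \<longrightarrow> P (embed_exponent t)"
        if "\<forall>u\<in>U. lookup u None \<noteq> 0 \<or> P u"
        using that by (auto simp: lookup_embed_exponent)
      show "\<forall>u\<in>U. lookup u None \<noteq> 0 \<or> P u"
        if t: "\<forall>t. embed_exponent t \<in> U \<longrightarrow> P (embed_exponent t)"
      proof
        fix u assume "u \<in> U"
        then show "lookup u None \<noteq> 0 \<or> P u" using t range_embed_exponent[of u] by blast
      qed
    qed
    then show ?thesis by (simp add: lookup_embed_exponent le_fun_def)
  qed
  ultimately show ?thesis
    unfolding adjoin_monomial_ideal
    by (intro set_eqI) (simp only: mem_vimage_monomial_ideal_iff mem_monomial_ideal_iff)
qed

text \<open>That is, \<open>L : v = J S\<close> for \<open>L = I S + v J S\<close>. A monomial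
  \<open>v u\<close> lies in \<open>L\<close> if and only if the part of \<open>u\<close> in the
  old variables lies in \<open>I\<close> or \<open>J\<close>, and the hypothesis says that
  \<open>I \<subseteq> J\<close>.\<close>
lemma colon_new_variable:
  assumes "\<And>a. a \<in> A \<Longrightarrow> \<exists>b\<in>B. lookup b \<le> lookup a"
  shows "colon (monomial_ideal (cone_exponents A B)) (single new_exponent 1) =
    (monomial_ideal (embed_exponent ` B) :: ('v::finite option, 'k::field) mpoly set)"
proof -
  have "(\<exists>a\<in>cone_exponents A B. lookup a \<le> lookup (new_exponent + u)) \<longleftrightarrow>
      (\<exists>b\<in>embed_exponent ` B. lookup b \<le> lookup u)" for u
  proof -
    have "(\<exists>a\<in>cone_exponents A B. lookup a \<le> lookup (new_exponent + u)) \<longleftrightarrow>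
      (\<exists>a\<in>A \<union> B. \<forall>x. lookup a x \<le> lookup u (Some x))"
      unfolding cone_exponents_def
      by (auto simp: bex_Un embed_exponent_le_iff new_plus_embed_exponent_le_iff lookup_add
          lookup_new_exponent)
    also have "\<dots> \<longleftrightarrow> (\<exists>b\<in>B. \<forall>x. lookup b x \<le> lookup u (Some x))"
    proof -
      have "\<exists>b\<in>B. \<forall>x. lookup b x \<le> lookup u (Some x)"
        if a: "a \<in> A" "\<forall>x. lookup a x \<le> lookup u (Some x)" for a
      proof -
        obtain b where "b \<in> B" "lookup b \<le> lookup a" using assms a(1) by blast
        then show ?thesis using a(2) unfolding le_fun_def by (meson order_trans)
      qed
      then show ?thesis by blast
    qed
    finally show ?thesis by (simp add: embed_exponent_le_iff)
  qed
  then show ?thesis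
    unfolding colon_def
    by (intro set_eqI) (simp add: mem_monomial_ideal_iff keys_mult_monomial)
qed

lemma nonzerodivisor_new_variable:
  "nonzerodivisor_mod (monomial_ideal (embed_exponent ` B) :: ('v::finite option, 'k::field) mpoly set)
    (single new_exponent 1)"
proof -
  have "colon (monomial_ideal (embed_exponent ` B)) (single new_exponent 1) =
      (monomial_ideal (embed_exponent ` B) :: ('v option, 'k) mpoly set)"
    unfolding colon_def
    by (intro set_eqI)
      (simp add: mem_monomial_ideal_iff keys_mult_monomial embed_exponent_le_iff
         lookup_add lookup_new_exponent)
  then show ?thesis
    unfolding nonzerodivisor_mod_def colon_def by (auto simp: mult.commute)
qed

text \<open>The algebraic content of the theorem, for arbitrary monomial ideals \<open>I
  \<subseteq> J\<close> with \<open>depth R/J < depth R/I\<close>: the depth of \<open>S/(I S + v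
  J S)\<close> is \<open>depth R/J + 1\<close>.\<close>
theorem depth_cone_exponents:
  fixes A B :: "('v::finite \<Rightarrow>\<^sub>0 nat) set"
  assumes AB: "\<And>a. a \<in> A \<Longrightarrow> \<exists>b\<in>B. lookup b \<le> lookup a" and "0 \<notin> B"
    and less: "depth_quot (monomial_ideal B :: ('v, 'k::field) mpoly set)
           < depth_quot (monomial_ideal A :: ('v, 'k) mpoly set)"
  shows "depth_quot (monomial_ideal (cone_exponents A B) :: ('v option, 'k) mpoly set) =
    depth_quot (monomial_ideal B :: ('v, 'k) mpoly set) + 1"
proof -
  define m where "m = (irrelevant_ideal :: ('v option, 'k) mpoly set)"
  define L where "L = (monomial_ideal (cone_exponents A B) :: ('v option, 'k) mpoly set)"
  define v where "v = (single new_exponent 1 :: ('v option, 'k) mpoly)"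
  interpret ideal_of_noetherian_ring m
    unfolding m_def by unfold_locales (simp_all add: noetherian_mpoly)
  have vimage: "depth_at_least m r (kill_new_variable -` I) \<longleftrightarrow> depth_at_least irrelevant_ideal r I"
    if "ideal.subspace I" for r and I :: "('v, 'k) mpoly set"
    unfolding m_def
    by (rule depth_at_least_vimage[OF kill_new_variable_add kill_new_variable_mult
          surj_kill_new_variable vimage_irrelevant_ideal that])
  have "0 \<notin> A"
  proof
    assume "0 \<in> A"
    then obtain b where "b \<in> B" "lookup b \<le> lookup 0" using AB by blast
    then have "b = 0" by (intro poly_mapping_eqI) (simp add: le_fun_def)
    then show False using \<open>b \<in> B\<close> \<open>0 \<notin> B\<close> by blast
  qed
  have zero: "0 \<notin> cone_exponents A B"
  proof -
    have "a = 0" if "embed_exponent a = 0" for a :: "'v \<Rightarrow>\<^sub>0 nat"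
      using injD[OF inj_embed_exponent, of a 0] that by simp
    moreover have "new_exponent + embed_exponent b \<noteq> 0" for b :: "'v \<Rightarrow>\<^sub>0 nat"
      by (simp add: eq_option_exponent_iff lookup_add lookup_new_exponent)
    ultimately show ?thesis using \<open>0 \<notin> A\<close> unfolding cone_exponents_def by fastforce
  qed
  have "v \<in> m"
    unfolding v_def m_def by (simp add: mem_irrelevant_ideal_iff lookup_single when_def eq_option_exponent_iff
        lookup_new_exponent)
  have ideal_L: "ideal.subspace L" unfolding L_def by simp
  have colon: "colon L v = monomial_ideal (embed_exponent ` B)"
    unfolding L_def v_def by (rule colon_new_variable[OF AB])
  have depth_adjoin: "depth_at_least m r (adjoin L v) \<longleftrightarrow>
      enat r \<le> depth_quot (monomial_ideal A :: ('v, 'k) mpoly set)" for r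
    unfolding enat_le_depth_quot_iff[OF \<open>0 \<notin> A\<close>] L_def v_def adjoin_new_variable
    by (rule vimage) simp
  \<comment> \<open>The apex variable is regular on \<open>S/JS\<close>, and \<open>S/(JS + v) = R/J\<close>.\<close>
  have depth_colon: "depth_at_least m (Suc r) (colon L v) \<longleftrightarrow>
      enat r \<le> depth_quot (monomial_ideal B :: ('v, 'k) mpoly set)" for r
  proof -
    have "depth_at_least m (Suc r) (colon L v) \<longleftrightarrow> depth_at_least m r (adjoin (colon L v) v)"
    proof (rule depth_at_least_Suc_iff[OF _ \<open>v \<in> m\<close>])
      show "ideal.subspace (colon L v)" by (rule ideal_colon[OF ideal_L])
      show "nonzerodivisor_mod (colon L v) v"
        unfolding colon unfolding v_def by (rule nonzerodivisor_new_variable)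
    qed
    also have "adjoin (colon L v) v = kill_new_variable -` monomial_ideal B"
      using adjoin_new_variable[of B "{}"] unfolding colon unfolding v_def by (simp add: cone_exponents_def)
    also have "depth_at_least m r \<dots> \<longleftrightarrow> enat r \<le> depth_quot (monomial_ideal B :: ('v, 'k) mpoly set)"
      unfolding enat_le_depth_quot_iff[OF \<open>0 \<notin> B\<close>] by (rule vimage) simp
    finally show ?thesis .
  qed
  \<comment> \<open>The depth of \<open>R/J\<close> is finite, being less than another depth.\<close>
  obtain d where d: "depth_quot (monomial_ideal B :: ('v, 'k) mpoly set) = enat d"
    using less by (metis enat_ord_simps(6) not_infinity_eq)
  have adjoin_d: "depth_at_least m (Suc d) (adjoin L v)"
    unfolding depth_adjoin using less d by (simp add: Suc_ile_eq)
  have "depth_at_least m (Suc d) L"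
    by (rule depth_at_least_from_colon_adjoin[OF ideal_L _ adjoin_d]) (simp add: depth_colon d del: depth_at_least.simps)
  moreover have "\<not> depth_at_least m (Suc (Suc d)) L"
  proof
    assume "depth_at_least m (Suc (Suc d)) L"
    from depth_at_least_colon[OF ideal_L this adjoin_d] show False
      by (simp add: depth_colon d del: depth_at_least.simps)
  qed
  ultimately have "enat (Suc d) \<le> depth_quot L" "\<not> enat (Suc (Suc d)) \<le> depth_quot L"
    unfolding L_def m_def enat_le_depth_quot_iff[OF zero] by simp_all
  then have "depth_quot L = enat (Suc d)"
    by (metis Suc_ile_eq antisym_conv2 not_le)
  then show ?thesis unfolding L_def[symmetric] d by (simp add: one_enat_def)
qed

section \<open>Matchings of the cone\<close>

definition set_exponent :: "'v::finite set \<Rightarrow> ('v \<Rightarrow>\<^sub>0 nat)" where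
  "set_exponent S = (\<Sum>x\<in>S. single x 1)"

lemma set_exponent_union:
  "S \<inter> T = {} \<Longrightarrow> set_exponent (S \<union> T) = set_exponent S + set_exponent T"
  unfolding set_exponent_def by (rule sum.union_disjoint) auto

lemma embed_set_exponent: "embed_exponent (set_exponent S) = set_exponent (Some ` S)"
proof -
  have "embed_exponent (\<Sum>x\<in>S. single x 1) = (\<Sum>x\<in>S. single (Some x) 1)"
    using finite[of S]
    by (induction S rule: finite_induct) (simp_all add: embed_exponent_add embed_exponent_single)
  then show ?thesis by (simp add: set_exponent_def sum.reindex)
qed

lemma vertex_monomial_conv_set_exponent: "vertex_monomial S = single (set_exponent S) 1"
  unfolding vertex_monomial_def set_exponent_def using finite[of S]
  by (induction S rule: finite_induct) (simp_all add: var_def mult_single)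

definition matching_exponents :: "'v::finite set set \<Rightarrow> nat \<Rightarrow> ('v \<Rightarrow>\<^sub>0 nat) set" where
  "matching_exponents E q = {set_exponent (\<Union>M) | M. is_matching E q M}"

definition J_exponents :: "'v::finite set set \<Rightarrow> nat \<Rightarrow> ('v \<Rightarrow>\<^sub>0 nat) set" where
  "J_exponents E q =
     {single x 1 + set_exponent (\<Union>M) | x M. is_matching (delete_vertex E x) (q - 1) M}"

lemma squarefree_power_monomial:
  "squarefree_power E q = monomial_ideal (matching_exponents E q)"
  unfolding squarefree_power_def monomial_ideal_def matching_exponents_def
  by (rule arg_cong[where f = ideal.span]) (auto simp: vertex_monomial_conv_set_exponent)

lemma J_ideal_monomial: "J_ideal E q = monomial_ideal (J_exponents E q)"
  unfolding J_ideal_def monomial_ideal_def J_exponents_def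
  by (rule arg_cong[where f = ideal.span])
    (auto simp: vertex_monomial_conv_set_exponent var_def mult_single intro!: image_eqI)

lemma J_exponents_nonzero: "0 \<notin> J_exponents E q"
proof -
  have "single x 1 + t \<noteq> 0" for x and t :: "'a \<Rightarrow>\<^sub>0 nat"
    by (metis add_is_0 lookup_add lookup_single_eq lookup_zero one_neq_zero)
  then show ?thesis unfolding J_exponents_def by (smt (verit) mem_Collect_eq)
qed

text \<open>This is the inclusion \<open>I(G)\<^sup>[\<^sup>q\<^sup>] \<subseteq>
  J\<^bsub>G,q\<^esub>\<close>. Remove an edge \<open>{x, y}\<close> from a
  \<open>q\<close>-matching: the remaining edges are a \<open>(q-1)\<close>-matching of the graph
  without \<open>x\<close>, and the monomial of the matching is \<open>y\<close> times a generator
  of \<open>J\<^bsub>G,q\<^esub>\<close>.\<close>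
lemma matching_exponent_ge_J_exponent:
  assumes E: "simple_graph E" and q: "q \<ge> 1" and a: "a \<in> matching_exponents E q"
  shows "\<exists>b\<in>J_exponents E q. lookup b \<le> lookup a"
proof -
  obtain M where M: "is_matching E q M" "a = set_exponent (\<Union>M)"
    using a unfolding matching_exponents_def by blast
  then obtain e where "e \<in> M" using q unfolding is_matching_def by fastforce
  then have "card e = 2" using M(1) E unfolding is_matching_def simple_graph_def by blast
  then obtain x y where e: "e = {x, y}" "x \<noteq> y" unfolding card_2_iff by blast
  have disj: "d \<inter> e = {}" if "d \<in> M - {e}" for d
    using M(1) \<open>e \<in> M\<close> that unfolding is_matching_def pairwise_def disjnt_def by blast
  have "is_matching (delete_vertex E x) (q - 1) (M - {e})"
    using M(1) \<open>e \<in> M\<close> disj e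
    unfolding is_matching_def delete_vertex_def by (auto simp: pairwise_def)
  then have "single x 1 + set_exponent (\<Union>(M - {e})) \<in> J_exponents E q"
    unfolding J_exponents_def by blast
  moreover have "a = single y 1 + (single x 1 + set_exponent (\<Union>(M - {e})))"
  proof -
    have "\<Union>M = e \<union> \<Union>(M - {e})" using \<open>e \<in> M\<close> by blast
    then have "a = set_exponent e + set_exponent (\<Union>(M - {e}))"
      using disj by (simp add: M(2)) (intro set_exponent_union, blast)
    also have "set_exponent e = single y 1 + single x 1"
      using e by (simp add: set_exponent_def add.commute)
    finally show ?thesis by (simp add: add.assoc)
  qed
  ultimately show ?thesis using lookup_le_iff by blast
qed

lemma is_matching_image:
  assumes "inj f"
  shows "is_matching E q ((`) f ` M) \<longleftrightarrow> is_matching {e. f ` e \<in> E} q M"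
proof -
  have "inj ((`) f)" using assms by (simp add: inj_image_eq_iff inj_def)
  then have "inj_on ((`) f) M" by (rule inj_on_subset) simp
  moreover have "disjnt (f ` a) (f ` b) \<longleftrightarrow> disjnt a b" for a b
    using assms by (auto simp: disjnt_def dest: injD)
  moreover have "f ` a = f ` b \<longleftrightarrow> a = b" for a b using assms by (rule inj_image_eq_iff)
  ultimately show ?thesis
    unfolding is_matching_def
    by (auto simp: card_image finite_image_iff pairwise_image pairwise_def)
qed

lemma Some_image_mem_cone_iff: "Some ` e \<in> cone E \<longleftrightarrow> e \<in> E"
  unfolding cone_def by (auto simp: inj_image_eq_iff)

lemma cone_edgeE:
  assumes "d \<in> cone E"
  obtains (old) e where "e \<in> E" "d = Some ` e" | (new) x where "d = {None, Some x}"
  using assms unfolding cone_def by blast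

text \<open>At most one edge of a matching of the cone contains the apex. The other edges are the
  images of edges of \<open>G\<close>, and if \<open>{v, x}\<close> is present, they avoid
  \<open>x\<close>.\<close>
lemma matching_exponents_cone:
  assumes q: "q \<ge> 1"
  shows "matching_exponents (cone E) q = cone_exponents (matching_exponents E q) (J_exponents E q)"
    (is "?L = ?R")
proof
  have old: "\<exists>N. M = (`) Some ` N" if "M \<subseteq> cone E" "None \<notin> \<Union>M" for M
  proof -
    have "M \<subseteq> range ((`) Some)"
    proof
      fix d assume "d \<in> M"
      then have "d \<in> cone E" "None \<notin> d" using that by auto
      then show "d \<in> range ((`) Some)" by (cases rule: cone_edgeE) auto
    qed
    then show ?thesis by (metis subset_imageE)
  qed
  have matching_old: "is_matching (cone E) r ((`) Some ` N) \<longleftrightarrow> is_matching E r N" for r N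
    by (simp add: is_matching_image Some_image_mem_cone_iff)
  have Union_old: "\<Union>((`) Some ` N) = Some ` \<Union>N" for N :: "'a set set" by blast
  show "?L \<subseteq> ?R"
  proof
    fix a assume "a \<in> ?L"
    then obtain M where M: "is_matching (cone E) q M" and a: "a = set_exponent (\<Union>M)"
      unfolding matching_exponents_def by blast
    show "a \<in> ?R"
    proof (cases "None \<in> \<Union>M")
      case False
      then obtain N where N: "M = (`) Some ` N"
        using old M unfolding is_matching_def by blast
      then have "is_matching E q N" using M matching_old by blast
      moreover have "a = embed_exponent (set_exponent (\<Union>N))"
        unfolding a N Union_old embed_set_exponent ..
      ultimately show ?thesis
        unfolding cone_exponents_def matching_exponents_def by blast
    next
      case True
      then obtain d where d: "d \<in> M" "None \<in> d" by blast
      then have "d \<in> cone E" using M unfolding is_matching_def by blast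
      then obtain x where x: "d = {None, Some x}" using d(2) by (cases rule: cone_edgeE) auto
      have disj: "c \<inter> d = {}" if "c \<in> M - {d}" for c
        using M d(1) that unfolding is_matching_def pairwise_def disjnt_def by blast
      have M': "is_matching (cone E) (q - 1) (M - {d})"
        using M d(1) unfolding is_matching_def by (auto simp: pairwise_def)
      then have sub: "M - {d} \<subseteq> cone E" unfolding is_matching_def by blast
      have "None \<notin> \<Union>(M - {d})" using disj d(2) by blast
      from old[OF sub this] obtain N where N: "M - {d} = (`) Some ` N" ..
      have "is_matching E (q - 1) N" using M' unfolding N matching_old .
      moreover have "x \<notin> e" if "e \<in> N" for e
        using disj[of "Some ` e"] that x unfolding N by auto
      ultimately have "is_matching (delete_vertex E x) (q - 1) N"
        unfolding is_matching_def delete_vertex_def by blast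
      then have "single x 1 + set_exponent (\<Union>N) \<in> J_exponents E q"
        unfolding J_exponents_def by blast
      moreover have "a = new_exponent + embed_exponent (single x 1 + set_exponent (\<Union>N))"
      proof -
        have "\<Union>M = d \<union> \<Union>(M - {d})" using d(1) by blast
        then have "a = set_exponent d + set_exponent (\<Union>(M - {d}))"
          unfolding a using disj by (simp only:) (intro set_exponent_union, blast)
        also have "set_exponent d = new_exponent + single (Some x) 1"
          unfolding x set_exponent_def new_exponent_def by simp
        also have "set_exponent (\<Union>(M - {d})) = embed_exponent (set_exponent (\<Union>N))"
          unfolding N Union_old embed_set_exponent ..
        finally show ?thesis by (simp add: embed_exponent_add embed_exponent_single add.assoc)
      qed
      ultimately show ?thesis unfolding cone_exponents_def by blast
    qed
  qed
  show "?R \<subseteq> ?L"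
  proof
    fix a assume "a \<in> ?R"
    then consider M where "is_matching E q M" "a = embed_exponent (set_exponent (\<Union>M))"
      | x M where "is_matching (delete_vertex E x) (q - 1) M"
          "a = new_exponent + embed_exponent (single x 1 + set_exponent (\<Union>M))"
      unfolding cone_exponents_def matching_exponents_def J_exponents_def by blast
    then show "a \<in> ?L"
    proof cases
      case 1
      have "a = set_exponent (\<Union>((`) Some ` M))"
        unfolding 1(2) Union_old embed_set_exponent ..
      moreover have "is_matching (cone E) q ((`) Some ` M)" using 1(1) matching_old by blast
      ultimately show ?thesis unfolding matching_exponents_def by blast
    next
      case 2
      let ?d = "{None, Some x}" and ?N = "(`) Some ` M"
      have M: "is_matching E (q - 1) M" and x: "x \<notin> \<Union>M"
        using 2(1) unfolding is_matching_def delete_vertex_def by auto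
      have disj: "?d \<inter> c = {}" if "c \<in> ?N" for c using that x by auto
      then have "?d \<notin> ?N" by blast
      have N: "is_matching (cone E) (q - 1) ?N" using M matching_old by blast
      have "?d \<in> cone E" unfolding cone_def by blast
      then have "is_matching (cone E) q (insert ?d ?N)"
        using N q \<open>?d \<notin> ?N\<close> disj unfolding is_matching_def
        by (auto simp: pairwise_insert disjnt_def)
      moreover have "a = set_exponent (\<Union>(insert ?d ?N))"
      proof -
        have "set_exponent (\<Union>(insert ?d ?N)) = set_exponent ?d + set_exponent (\<Union>?N)"
          unfolding Union_insert using disj by (intro set_exponent_union) blast
        also have "set_exponent ?d = new_exponent + single (Some x) 1"
          unfolding set_exponent_def new_exponent_def by simp
        also have "set_exponent (\<Union>?N) = embed_exponent (set_exponent (\<Union>M))"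
          unfolding Union_old embed_set_exponent ..
        finally show ?thesis
          unfolding 2(2) by (simp add: embed_exponent_add embed_exponent_single add.assoc)
      qed
      ultimately show ?thesis unfolding matching_exponents_def by blast
    qed
  qed
qed

theorem theorem4p6:
  fixes E :: "'v::finite set set" and q :: nat
  assumes "simple_graph E"
    and "q \<ge> 1"
    and "depth_quot (squarefree_power E q :: ('v, 'k::field) mpoly set)
           > depth_quot (J_ideal E q :: ('v, 'k) mpoly set)"
  shows "depth_quot (squarefree_power (cone E) q :: ('v option, 'k) mpoly set)
           = depth_quot (J_ideal E q :: ('v, 'k) mpoly set) + 1"
  using depth_cone_exponents[OF matching_exponent_ge_J_exponent[OF assms(1,2)] J_exponents_nonzero]
    assms(3)
  unfolding squarefree_power_monomial J_ideal_monomial matching_exponents_cone[OF assms(2)] by blast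

end
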